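(* The reduction relation $\to_{dB}$ of PPC_dB is confluent: whenever $t\to_{dB}^*t_0$ and $t\to_{dB}^*t_1$, there exists $t'$ with $t_0\to_{dB}^*t'$ and $t_1\to_{dB}^*t'$.
   Context: **PPC_dB terms.** Terms: $t::=\mathsf v_{i,j}\mid\mathsf m_{i,j}\mid t\,t\mid\lambda_np.s$, with $i,j\ge1$ integers (variable and matchable bidimensional indices, with primary index $i$) and $n\in\mathbb N$. Equality of terms is modulo permutation of the secondary indices bound by the same abstraction. **Increments and decrement.** - $\uparrow^{\mathsf v}_k\mathsf v_{i,j}=\mathsf v_{i+1,j}$ if $i>k$, else unchanged; matchable indices unchanged; homomorphic on applications; $\uparrow^{\mathsf v}_k(\lambda_np.s)=\lambda_n\uparrow^{\mathsf v}_kp.\uparrow^{\mathsf v}_{k+1}s$. - $\uparrow^{\mathsf m}_k$ is the symmetric operation on matchable indices (leaving variable indices unchanged), with $\uparrow^{\mathsf m}_k(\lambda_np.s)=\lambda_n\uparrow^{\mathsf m}_{k+1}p.\uparrow^{\mathsf m}_ks$. - $\downarrow^{\mathsf v}_k$ is like $\uparrow^{\mathsf v}_k$ but subtracts $1$. - The default depth is $0$. **Substitution.** A substitution at level $i$, $\{\mathsf v_{i,j}\mapsto u_j\}_{j\in J}$: - maps $\mathsf v_{i,k}$ to $u_k$ for $k\in J$, and leaves $\mathsf v_{i',k}$ with $i'\ne i$ and all matchable indices unchanged; - is homomorphic on applications; - maps $\lambda_np.s$ to $\lambda_n(\{\mathsf v_{i,j}\mapsto\uparrow^{\mathsf m}u_j\}p).(\{\mathsf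 v_{i+1,j}\mapsto\uparrow^{\mathsf v}u_j\}s)$. **Matching.** A match is a substitution, $\mathtt{fail}$ or $\mathtt{wait}$ (decided if not $\mathtt{wait}$). Data structures are $d::=\mathsf m_{i,j}\mid d\,t$; matchable forms are $m::=d\mid\lambda_nt.t$. $\mu\uplus\mu'$ is $\mathtt{fail}$ if either match is $\mathtt{fail}$; else $\mathtt{wait}$ if either is $\mathtt{wait}$; else $\mathtt{fail}$ if the domains intersect; else the union. Matching $\{p/u\}_n$ (first applicable clause): 1. $\{\mathsf m_{1,j}/u\}_n=\{\mathsf v_{1,j}\mapsto u\}$; 2. $\{\mathsf m_{i+1,j}/\mathsf m_{i,j}\}_n=\{\}$; 3. $\{p\,q/t\,u\}_n=\{p/t\}_n\uplus\{q/u\}_n$ if both are matchable forms; 4. $\mathtt{fail}$ if $p,u$ are matchable forms; 5. $\mathtt{wait}$ otherwise. A substitution result whose domain is not $\{\mathsf v_{1,1},\dots,\mathsf v_{1,n}\}$ becomes $\mathtt{fail}$. $\mathtt{fail}$ applied to any term gives $\lambda_1\mathsf m_{1,1}.\mathsf v_{1,1}$. **Reduction.** $\to_{dB}$ is the closure under all contexts of $(\lambda_np.s)u\to\downarrow^{\mathsf v}(\{p/\uparrow^{\mathsf v}u\}_ns)$, whenever the match is decided.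
   Formalization: Terms are required to be well-formed: in every λ_n p.s, the matchable indices of p and the variable indices of s at that abstraction's level have secondary index at most n; otherwise the decrement can yield v_{0,j} or captured indices and confluence fails. *)

theory Defs
  imports "HOL-Combinatorics.Permutations"
begin

text \<open>Raw terms: \<open>Var i j\<close> and \<open>Mat i j\<close> are the variable and matchable indices with primary
  index \<open>i\<close> and secondary index \<open>j\<close>, and \<open>Lam n p s\<close> is the abstraction binding \<open>n\<close> indices, with
  pattern \<open>p\<close> and body \<open>s\<close>.\<close>

datatype pterm =
    Var nat nat
  | Mat nat nat
  | App pterm pterm
  | Lam nat pterm pterm

text \<open>An abstraction binds the matchable indices of its pattern and the variable indices of its body.
  The sets below contain the free indices, as pairs of a primary and a secondary index.\<close>

primrec fv :: "pterm \<Rightarrow> (nat \<times> nat) set" where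
  "fv (Var i j) = {(i, j)}"
| "fv (Mat i j) = {}"
| "fv (App t u) = fv t \<union> fv u"
| "fv (Lam n p s) = fv p \<union> {(i, j). 1 \<le> i \<and> (i + 1, j) \<in> fv s}"

primrec fm :: "pterm \<Rightarrow> (nat \<times> nat) set" where
  "fm (Var i j) = {}"
| "fm (Mat i j) = {(i, j)}"
| "fm (App t u) = fm t \<union> fm u"
| "fm (Lam n p s) = {(i, j). 1 \<le> i \<and> (i + 1, j) \<in> fm p} \<union> fm s"

text \<open>Indices start at 1, and an index lying in the scope of its abstraction \<open>Lam n p s\<close> has a
  secondary index in the range \<open>1, ..., n\<close>.  Free secondary indices are not restricted.  Without the
  range condition a step could decrement the primary index of an unsubstituted \<open>Var 1 j\<close>, or let
  another binder capture it, and reduction would not be confluent.\<close>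

primrec well_formed :: "pterm \<Rightarrow> bool" where
  "well_formed (Var i j) \<longleftrightarrow> 1 \<le> i \<and> 1 \<le> j"
| "well_formed (Mat i j) \<longleftrightarrow> 1 \<le> i \<and> 1 \<le> j"
| "well_formed (App t u) \<longleftrightarrow> well_formed t \<and> well_formed u"
| "well_formed (Lam n p s) \<longleftrightarrow> well_formed p \<and> well_formed s \<and>
     (\<forall>j. (1, j) \<in> fm p \<longrightarrow> j \<le> n) \<and> (\<forall>j. (1, j) \<in> fv s \<longrightarrow> j \<le> n)"

subsection \<open>Permutation of bound secondary indices\<close>

text \<open>\<open>perm_var k \<pi>\<close> applies \<open>\<pi>\<close> to the secondary indices of the free variable indices whose primary
  index is \<open>k\<close>; \<open>perm_mat\<close> does the same for matchable indices.\<close>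

primrec perm_var :: "nat \<Rightarrow> (nat \<Rightarrow> nat) \<Rightarrow> pterm \<Rightarrow> pterm" where
  "perm_var k \<pi> (Var i j) = Var i (if i = k then \<pi> j else j)"
| "perm_var k \<pi> (Mat i j) = Mat i j"
| "perm_var k \<pi> (App t u) = App (perm_var k \<pi> t) (perm_var k \<pi> u)"
| "perm_var k \<pi> (Lam n p s) = Lam n (perm_var k \<pi> p) (perm_var (k + 1) \<pi> s)"

primrec perm_mat :: "nat \<Rightarrow> (nat \<Rightarrow> nat) \<Rightarrow> pterm \<Rightarrow> pterm" where
  "perm_mat k \<pi> (Var i j) = Var i j"
| "perm_mat k \<pi> (Mat i j) = Mat i (if i = k then \<pi> j else j)"
| "perm_mat k \<pi> (App t u) = App (perm_mat k \<pi> t) (perm_mat k \<pi> u)"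
| "perm_mat k \<pi> (Lam n p s) = Lam n (perm_mat (k + 1) \<pi> p) (perm_mat k \<pi> s)"

inductive perm_eq :: "pterm \<Rightarrow> pterm \<Rightarrow> bool" where
  refl: "perm_eq t t"
| sym: "perm_eq t u \<Longrightarrow> perm_eq u t"
| trans: "perm_eq t u \<Longrightarrow> perm_eq u v \<Longrightarrow> perm_eq t v"
| App: "perm_eq t t' \<Longrightarrow> perm_eq u u' \<Longrightarrow> perm_eq (App t u) (App t' u')"
| Lam: "perm_eq p p' \<Longrightarrow> perm_eq s s' \<Longrightarrow> perm_eq (Lam n p s) (Lam n p' s')"
| perm: "\<pi> permutes {1..n} \<Longrightarrow> perm_eq (Lam n p s) (Lam n (perm_mat 1 \<pi> p) (perm_var 1 \<pi> s))"

definition term_eq :: "pterm \<Rightarrow> pterm \<Rightarrow> bool" where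
  "term_eq t u \<longleftrightarrow> well_formed t \<and> well_formed u \<and> perm_eq t u"

quotient_type ppc_term = pterm / partial: term_eq
proof (rule part_equivpI)
  show "\<exists>t. term_eq t t"
    by (rule exI[of _ "Var 1 1"]) (simp add: term_eq_def perm_eq.refl)
  show "symp term_eq"
    by (rule sympI) (auto simp: term_eq_def intro: perm_eq.sym)
  show "transp term_eq"
    by (rule transpI) (auto simp: term_eq_def intro: perm_eq.trans)
qed

subsection \<open>Increments and decrement\<close>

primrec inc_var :: "nat \<Rightarrow> pterm \<Rightarrow> pterm" where
  "inc_var k (Var i j) = Var (if i > k then i + 1 else i) j"
| "inc_var k (Mat i j) = Mat i j"
| "inc_var k (App t u) = App (inc_var k t) (inc_var k u)"
| "inc_var k (Lam n p s) = Lam n (inc_var k p) (inc_var (k + 1) s)"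

primrec inc_mat :: "nat \<Rightarrow> pterm \<Rightarrow> pterm" where
  "inc_mat k (Var i j) = Var i j"
| "inc_mat k (Mat i j) = Mat (if i > k then i + 1 else i) j"
| "inc_mat k (App t u) = App (inc_mat k t) (inc_mat k u)"
| "inc_mat k (Lam n p s) = Lam n (inc_mat (k + 1) p) (inc_mat k s)"

primrec dec_var :: "nat \<Rightarrow> pterm \<Rightarrow> pterm" where
  "dec_var k (Var i j) = Var (if i > k then i - 1 else i) j"
| "dec_var k (Mat i j) = Mat i j"
| "dec_var k (App t u) = App (dec_var k t) (dec_var k u)"
| "dec_var k (Lam n p s) = Lam n (dec_var k p) (dec_var (k + 1) s)"

subsection \<open>Substitution\<close>

text \<open>\<open>subst i \<sigma>\<close> is the substitution at level \<open>i\<close> sending \<open>Var i j\<close> to \<open>u\<close> whenever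
  \<open>\<sigma> j = Some u\<close>.\<close>

primrec subst :: "nat \<Rightarrow> (nat \<rightharpoonup> pterm) \<Rightarrow> pterm \<Rightarrow> pterm" where
  "subst i \<sigma> (Var i' j) =
     (if i' = i then (case \<sigma> j of Some u \<Rightarrow> u | None \<Rightarrow> Var i' j) else Var i' j)"
| "subst i \<sigma> (Mat i' j) = Mat i' j"
| "subst i \<sigma> (App t u) = App (subst i \<sigma> t) (subst i \<sigma> u)"
| "subst i \<sigma> (Lam n p s) =
     Lam n (subst i (map_option (inc_mat 0) \<circ> \<sigma>) p)
           (subst (i + 1) (map_option (inc_var 0) \<circ> \<sigma>) s)"

subsection \<open>Matching\<close>

text \<open>\<open>Subst \<sigma>\<close> stands for the level-1 substitution given by \<open>\<sigma>\<close>.\<close>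

datatype matching = Subst "nat \<rightharpoonup> pterm" | Fail | Wait

fun data_structure :: "pterm \<Rightarrow> bool" where
  "data_structure (Mat i j) \<longleftrightarrow> True"
| "data_structure (App d t) \<longleftrightarrow> data_structure d"
| "data_structure _ \<longleftrightarrow> False"

definition matchable_form :: "pterm \<Rightarrow> bool" where
  "matchable_form t \<longleftrightarrow> data_structure t \<or> (\<exists>n p s. t = Lam n p s)"

fun match_union :: "matching \<Rightarrow> matching \<Rightarrow> matching" where
  "match_union (Subst \<sigma>) (Subst \<tau>) = (if dom \<sigma> \<inter> dom \<tau> \<noteq> {} then Fail else Subst (\<sigma> ++ \<tau>))"
| "match_union \<mu> \<nu> = (if \<mu> = Fail \<or> \<nu> = Fail then Fail else Wait)"

text \<open>Matching before the check on the domain of the resulting substitution.  That check concerns the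
  final result only, since a component of an application binds only some of the \<open>n\<close> indices.\<close>

fun compound_match :: "pterm \<Rightarrow> pterm \<Rightarrow> matching" where
  "compound_match (Mat i j) u =
     (if i = 1 then Subst [j \<mapsto> u]
      else if \<exists>i'. i = i' + 1 \<and> u = Mat i' j then Subst Map.empty
      else if matchable_form u then Fail
      else Wait)"
| "compound_match (App p q) (App t u) =
     (if matchable_form (App p q) \<and> matchable_form (App t u)
      then match_union (compound_match p t) (compound_match q u)
      else Wait)"
| "compound_match p u = (if matchable_form p \<and> matchable_form u then Fail else Wait)"

definition match :: "nat \<Rightarrow> pterm \<Rightarrow> pterm \<Rightarrow> matching" where
  "match n p u =
     (case compound_match p u of
        Subst \<sigma> \<Rightarrow> if dom \<sigma> = {1..n} then Subst \<sigma> else Fail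
      | Fail \<Rightarrow> Fail
      | Wait \<Rightarrow> Wait)"

text \<open>The value at \<open>Wait\<close> is irrelevant, because only decided matches fire.\<close>

fun apply_match :: "matching \<Rightarrow> pterm \<Rightarrow> pterm" where
  "apply_match (Subst \<sigma>) s = subst 1 \<sigma> s"
| "apply_match Fail s = Lam 1 (Mat 1 1) (Var 1 1)"
| "apply_match Wait s = s"

subsection \<open>Reduction\<close>

inductive raw_red :: "pterm \<Rightarrow> pterm \<Rightarrow> bool" where
  beta: "match n p (inc_var 0 u) \<noteq> Wait \<Longrightarrow>
     raw_red (App (Lam n p s) u) (dec_var 0 (apply_match (match n p (inc_var 0 u)) s))"
| AppL: "raw_red t t' \<Longrightarrow> raw_red (App t u) (App t' u)"
| AppR: "raw_red u u' \<Longrightarrow> raw_red (App t u) (App t u')"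
| LamP: "raw_red p p' \<Longrightarrow> raw_red (Lam n p s) (Lam n p' s)"
| LamB: "raw_red s s' \<Longrightarrow> raw_red (Lam n p s) (Lam n p s')"

text \<open>Reduction of terms modulo permutation: some representatives reduce.  Reduction preserves
  well-formedness; requiring it of \<open>u\<close> only ensures that \<open>abs_ppc_term u\<close> is meaningful.\<close>

definition red :: "ppc_term \<Rightarrow> ppc_term \<Rightarrow> bool" (infix "\<rightarrow>\<^sub>d\<^sub>B" 50) where
  "T \<rightarrow>\<^sub>d\<^sub>B U \<longleftrightarrow> (\<exists>t u. well_formed t \<and> well_formed u \<and>
     T = abs_ppc_term t \<and> U = abs_ppc_term u \<and> raw_red t u)"

end

theory Submission
  imports Defs "HOL-Library.Confluence"
begin

text \<open>
  Confluence is obtained by Takahashi's method for a parallel reduction on raw terms.  A parallel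
  step may also permute the secondary indices of every abstraction it meets, so that its transitive
  closure contains \<open>perm_eq\<close> and no separate commutation of reduction with the equality of terms is
  needed.  Everything rests on the stability of decided matches under reduction, substitution and
  permutation: failures persist because they are caused by the shapes of matchable forms, and
  successes persist because a pattern that matches successfully contains neither variables nor redexes.

  Increments, permutations and the substitution performed by a step (composed with the decrement) are
  all instances of one simultaneous operation \<open>msubst\<close>, which replaces the variable indices by terms
  and renames the matchable indices; it satisfies a single composition law.  Well-formedness is needed
  only to see that a step is such an instance.
\<close>

section \<open>Simultaneous substitution and renaming\<close>

fun up :: "nat \<Rightarrow> nat \<times> nat \<Rightarrow> nat \<times> nat" where
  "up k (i, j) = (if i > k then i + 1 else i, j)"

fun perm_index :: "nat \<Rightarrow> (nat \<Rightarrow> nat) \<Rightarrow> nat \<times> nat \<Rightarrow> nat \<times> nat" where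
  "perm_index k \<pi> (i, j) = (i, if i = k then \<pi> j else j)"

text \<open>Action of \<open>\<rho>\<close> under one more binder: primary index 1 is the newly
  bound one and stays, and free indices are shifted down, renamed and shifted back.\<close>

fun lift_index :: "(nat \<times> nat \<Rightarrow> nat \<times> nat) \<Rightarrow> nat \<times> nat \<Rightarrow> nat \<times> nat" where
  "lift_index \<rho> (0, j) = (0, j)"
| "lift_index \<rho> (Suc 0, j) = (Suc 0, j)"
| "lift_index \<rho> (Suc (Suc i), j) = up 0 (\<rho> (Suc i, j))"

fun lift_var :: "(nat \<times> nat \<Rightarrow> pterm) \<Rightarrow> nat \<times> nat \<Rightarrow> pterm" where
  "lift_var f (0, j) = Var 0 j"
| "lift_var f (Suc 0, j) = Var (Suc 0) j"
| "lift_var f (Suc (Suc i), j) = inc_var 0 (f (Suc i, j))"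

text \<open>Primary indices start at 1; \<open>Var 0 j\<close> is kept fixed so that the laws below hold for all raw terms.\<close>

primrec msubst :: "(nat \<times> nat \<Rightarrow> pterm) \<Rightarrow> (nat \<times> nat \<Rightarrow> nat \<times> nat) \<Rightarrow> pterm \<Rightarrow> pterm" where
  "msubst f \<rho> (Var i j) = (if i = 0 then Var 0 j else f (i, j))"
| "msubst f \<rho> (Mat i j) = case_prod Mat (\<rho> (i, j))"
| "msubst f \<rho> (App t u) = App (msubst f \<rho> t) (msubst f \<rho> u)"
| "msubst f \<rho> (Lam n p s) =
     Lam n (msubst (inc_mat 0 \<circ> f) (lift_index \<rho>) p) (msubst (lift_var f) \<rho> s)"

text \<open>Injectivity keeps distinct matchable indices distinct, so that failed comparisons stay
  failed. Positive primary indices stay positive, so that shifted indices never meet the bound index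
  1.\<close>

definition index_renaming :: "(nat \<times> nat \<Rightarrow> nat \<times> nat) \<Rightarrow> bool" where
  "index_renaming \<rho> \<longleftrightarrow> inj \<rho> \<and> (\<forall>i j. fst (\<rho> (i, j)) = 0 \<longleftrightarrow> i = 0) \<and> (\<forall>j. \<rho> (0, j) = (0, j))"

abbreviation rename :: "(nat \<times> nat \<Rightarrow> nat \<times> nat) \<Rightarrow> (nat \<times> nat \<Rightarrow> nat \<times> nat) \<Rightarrow> pterm \<Rightarrow> pterm"
  where "rename \<alpha> \<equiv> msubst (case_prod Var \<circ> \<alpha>)"

lemma index_renaming_Suc:
  assumes "index_renaming \<rho>"
  obtains i' j' where "\<rho> (Suc i, j) = (Suc i', j')"
proof (cases "\<rho> (Suc i, j)")
  case (Pair a b)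
  have "fst (\<rho> (Suc i, j)) \<noteq> 0" using assms by (simp add: index_renaming_def)
  with Pair that show thesis by (cases a) auto
qed

lemma index_renaming_zero: "index_renaming \<rho> \<Longrightarrow> \<rho> (0, j) = (0, j)"
  by (simp add: index_renaming_def)

lemma index_renaming_id [simp]: "index_renaming id"
  by (simp add: index_renaming_def)

lemma index_renaming_up [simp]: "index_renaming (up k)"
proof -
  have "x = y" if "up k x = up k y" for x y
    using that by (cases x; cases y) (simp split: if_splits)
  then show ?thesis by (simp add: index_renaming_def inj_def)
qed

lemma index_renaming_perm_index [simp]:
  assumes "bij \<pi>" "k \<noteq> 0"
  shows "index_renaming (perm_index k \<pi>)"
proof -
  have "x = y" if "perm_index k \<pi> x = perm_index k \<pi> y" for x y
    using that \<open>bij \<pi>\<close> by (cases x; cases y) (simp add: bij_is_inj inj_eq split: if_splits)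
  then show ?thesis using \<open>k \<noteq> 0\<close> by (simp add: index_renaming_def inj_def)
qed

lemma index_cases:
  obtains (zero) j where "x = (0, j)" | (one) j where "x = (Suc 0, j)"
    | (Suc) i j where "x = (Suc (Suc i), j)"
proof (cases x)
  case (Pair i j)
  then show thesis
    using zero one Suc by (cases i rule: nat.exhaust; cases "i - 1" rule: nat.exhaust) auto
qed

lemma index_renaming_lift [simp]:
  assumes \<rho>: "index_renaming \<rho>"
  shows "index_renaming (lift_index \<rho>)"
proof -
  \<comment> \<open>Shifted indices land at 2 or above, so the images of the three cases of
    \<open>index_cases\<close> are disjoint.\<close>
  have *: "\<exists>i' j'. lift_index \<rho> (Suc (Suc i), j) = (Suc (Suc i'), j')" for i j
    by (rule index_renaming_Suc[OF \<rho>, of i j]) simp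
  have inj: "x = y" if "lift_index \<rho> x = lift_index \<rho> y" for x y
  proof (cases x rule: index_cases)
    case zero
    with that * show ?thesis
      by (cases y rule: index_cases) (simp, simp,
          metis prod.inject nat.distinct(1) lift_index.simps(1))
  next
    case one
    with that * show ?thesis
      by (cases y rule: index_cases) (simp, simp,
          metis prod.inject nat.inject nat.distinct(1) lift_index.simps(2))
  next
    case (Suc i j)
    with that * obtain i' j' where y: "y = (Suc (Suc i'), j')"
      by (cases y rule: index_cases)
        (metis prod.inject nat.inject nat.distinct(1) lift_index.simps)+
    have "up 0 (\<rho> (Suc i, j)) = up 0 (\<rho> (Suc i', j'))" using that Suc y by simp
    then have "\<rho> (Suc i, j) = \<rho> (Suc i', j')"
      using index_renaming_up[of 0] by (simp add: index_renaming_def inj_eq)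
    then show ?thesis using \<rho> Suc y by (simp add: index_renaming_def inj_eq)
  qed
  have "fst (lift_index \<rho> (i, j)) = 0 \<longleftrightarrow> i = 0" for i j
  proof (cases "(i, j)" rule: index_cases)
    case (Suc i' j')
    with *[of i' j'] show ?thesis by (auto simp del: lift_index.simps)
  qed simp_all
  with inj show ?thesis by (simp add: index_renaming_def inj_def)
qed

lemma lift_index_id [simp]: "lift_index id = id"
  by (rule ext, rule_tac x = x in index_cases) simp_all

lemma lift_index_up [simp]: "lift_index (up k) = up (Suc k)"
  by (rule ext, rule_tac x = x in index_cases) simp_all

lemma lift_index_perm_index [simp]:
  "k \<noteq> 0 \<Longrightarrow> lift_index (perm_index k \<pi>) = perm_index (Suc k) \<pi>"
  by (rule ext, rule_tac x = x in index_cases) auto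

lemma lift_index_comp:
  assumes "index_renaming \<rho>'"
  shows "lift_index \<rho> \<circ> lift_index \<rho>' = lift_index (\<rho> \<circ> \<rho>')"
proof
  fix x show "(lift_index \<rho> \<circ> lift_index \<rho>') x = lift_index (\<rho> \<circ> \<rho>') x"
  proof (cases x rule: index_cases)
    case (Suc i j)
    then show ?thesis by (auto intro: index_renaming_Suc[OF assms, of i j])
  qed simp_all
qed

lemma lift_index_comp_up:
  assumes "index_renaming \<rho>"
  shows "lift_index \<rho> \<circ> up 0 = up 0 \<circ> \<rho>"
proof
  fix x show "(lift_index \<rho> \<circ> up 0) x = (up 0 \<circ> \<rho>) x"
    by (cases x rule: index_cases) (simp_all add: index_renaming_zero[OF assms] numeral_2_eq_2)
qed

section \<open>Increments and permutations as renamings\<close>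

lemma inc_mat_Var [simp]: "inc_mat k \<circ> (case_prod Var \<circ> \<alpha>) = case_prod Var \<circ> \<alpha>"
  by (auto simp: fun_eq_iff split: prod.split)

lemma inc_mat_Var' [simp]: "inc_mat k \<circ> case_prod Var = case_prod Var"
  by (auto simp: fun_eq_iff split: prod.split)

lemma lift_var_Var [simp]: "lift_var (case_prod Var \<circ> \<alpha>) = case_prod Var \<circ> lift_index \<alpha>"
  by (rule ext, rule_tac x = x in index_cases) (simp_all split: prod.split)

lemma lift_var_Var' [simp]: "lift_var (case_prod Var) = case_prod Var"
  using lift_var_Var[of id] by simp

lemma inc_var_eq_rename: "inc_var k t = rename (up k) id t"
  by (induction t arbitrary: k) auto

lemma inc_mat_eq_rename: "inc_mat k t = rename id (up k) t"
  by (induction t arbitrary: k) auto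

text \<open>Level 0 is excluded because \<open>msubst\<close> fixes \<open>Var 0 j\<close>, whereas
  \<open>perm_var 0\<close> would permute it.\<close>

lemma perm_var_eq_rename: "k \<noteq> 0 \<Longrightarrow> perm_var k \<pi> t = rename (perm_index k \<pi>) id t"
  by (induction t arbitrary: k) auto

lemma perm_mat_eq_rename: "k \<noteq> 0 \<Longrightarrow> perm_mat k \<pi> t = rename id (perm_index k \<pi>) t"
  by (induction t arbitrary: k) auto

lemma msubst_cong:
  "(\<And>i j. f (Suc i, j) = g (Suc i, j)) \<Longrightarrow> msubst f \<rho> t = msubst g \<rho> t"
proof (induction t arbitrary: f g \<rho>)
  case (Var i j)
  then show ?case by (cases i) simp_all
next
  case (Mat i j)
  show ?case by simp
next
  case (App t u)
  show ?case using App.prems by (simp add: App.IH[where f = f and g = g])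
next
  case (Lam n p s)
  have "lift_var f (Suc i, j) = lift_var g (Suc i, j)" for i j
    using Lam.prems by (cases i) simp_all
  then have "msubst (lift_var f) \<rho> s = msubst (lift_var g) \<rho> s"
    by (rule Lam.IH(2))
  moreover have "msubst (inc_mat 0 \<circ> f) (lift_index \<rho>) p = msubst (inc_mat 0 \<circ> g) (lift_index \<rho>) p"
    by (rule Lam.IH(1)) (simp add: Lam.prems)
  ultimately show ?case by simp
qed

lemma msubst_id [simp]: "msubst (case_prod Var) id t = t"
  by (induction t) (simp_all only: msubst.simps inc_mat_Var' lift_var_Var' lift_index_id, simp_all)

text \<open>First stage of the composition law \<open>msubst_msubst\<close>. The general law needs
  increments to commute with substitution; as increments are renamings, the laws with a renaming
  inside and then outside come first.\<close>

lemma msubst_rename: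
  assumes "index_renaming \<alpha>" "index_renaming \<rho>" "index_renaming \<rho>'"
  shows "msubst f \<rho> (rename \<alpha> \<rho>' t) = msubst (f \<circ> \<alpha>) (\<rho> \<circ> \<rho>') t"
  using assms
proof (induction t arbitrary: f \<alpha> \<rho> \<rho>')
  case (Var i j)
  show ?case
  proof (cases i)
    case (Suc i')
    then show ?thesis by (auto intro: index_renaming_Suc[OF \<open>index_renaming \<alpha>\<close>, of i' j])
  qed simp
next
  case (Lam n p s)
  have "lift_var f \<circ> lift_index \<alpha> = lift_var (f \<circ> \<alpha>)"
  proof
    fix x show "(lift_var f \<circ> lift_index \<alpha>) x = lift_var (f \<circ> \<alpha>) x"
    proof (cases x rule: index_cases)
      case (Suc i j)
      then show ?thesis by (auto intro: index_renaming_Suc[OF \<open>index_renaming \<alpha>\<close>, of i j])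
    qed simp_all
  qed
  then show ?case
    using Lam.prems
    by (simp only: msubst.simps inc_mat_Var lift_var_Var Lam.IH index_renaming_lift lift_index_comp comp_assoc)
qed (simp_all split: prod.split)

lemma inc_var_rename:
  assumes "index_renaming \<alpha>" "index_renaming \<rho>"
  shows "rename (lift_index \<alpha>) \<rho> (inc_var 0 t) = inc_var 0 (rename \<alpha> \<rho> t)"
  using assms by (simp add: inc_var_eq_rename msubst_rename comp_assoc lift_index_comp_up)

lemma inc_mat_rename:
  assumes "index_renaming \<alpha>" "index_renaming \<rho>"
  shows "rename \<alpha> (lift_index \<rho>) (inc_mat 0 t) = inc_mat 0 (rename \<alpha> \<rho> t)"
  using assms
  by (simp add: inc_mat_eq_rename msubst_rename comp_assoc lift_index_comp_up del: comp_id id_comp)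
    simp

text \<open>Second stage. Below a binder, the renaming is moved past the increments of the
  substituted terms by \<open>inc_var_rename\<close> and \<open>inc_mat_rename\<close>.\<close>

lemma rename_msubst:
  assumes "index_renaming \<alpha>" "index_renaming \<rho>" "index_renaming \<rho>'"
  shows "rename \<alpha> \<rho> (msubst f \<rho>' t) = msubst (rename \<alpha> \<rho> \<circ> f) (\<rho> \<circ> \<rho>') t"
  using assms
proof (induction t arbitrary: f \<alpha> \<rho> \<rho>')
  case (Var i j)
  then show ?case by (simp add: index_renaming_zero)
next
  case (Lam n p s)
  have "rename (lift_index \<alpha>) \<rho> \<circ> lift_var f = lift_var (rename \<alpha> \<rho> \<circ> f)"
  proof
    fix x show "(rename (lift_index \<alpha>) \<rho> \<circ> lift_var f) x = lift_var (rename \<alpha> \<rho> \<circ> f) x"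
      using Lam.prems by (cases x rule: index_cases) (simp_all add: inc_var_rename)
  qed
  moreover have "rename \<alpha> (lift_index \<rho>) \<circ> (inc_mat 0 \<circ> f) = inc_mat 0 \<circ> (rename \<alpha> \<rho> \<circ> f)"
    using Lam.prems by (simp add: fun_eq_iff inc_mat_rename)
  ultimately show ?case
    using Lam.prems
    by (simp only: msubst.simps inc_mat_Var lift_var_Var Lam.IH index_renaming_lift lift_index_comp)
qed (simp_all split: prod.split)

text \<open>By the first two stages both sides become a single \<open>msubst\<close>. The two
  environments may differ at primary index 0, hence the use of \<open>msubst_cong\<close>.\<close>

lemma inc_var_msubst:
  assumes "index_renaming \<rho>"
  shows "msubst (lift_var f) \<rho> (inc_var 0 t) = inc_var 0 (msubst f \<rho> t)"
  using assms
  by (auto simp: inc_var_eq_rename msubst_rename rename_msubst intro!: msubst_cong)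

lemma inc_mat_msubst:
  assumes "index_renaming \<rho>"
  shows "msubst (inc_mat 0 \<circ> f) (lift_index \<rho>) (inc_mat 0 t) = inc_mat 0 (msubst f \<rho> t)"
proof -
  have "inc_mat 0 = rename id (up 0)" by (simp add: fun_eq_iff inc_mat_eq_rename)
  then show ?thesis
    using assms by (simp add: msubst_rename rename_msubst lift_index_comp_up del: comp_id) simp
qed

lemma msubst_msubst:
  assumes "index_renaming \<rho>" "index_renaming \<rho>'"
  shows "msubst f \<rho> (msubst g \<rho>' t) = msubst (msubst f \<rho> \<circ> g) (\<rho> \<circ> \<rho>') t"
  using assms
proof (induction t arbitrary: f g \<rho> \<rho>')
  case (Lam n p s)
  have "msubst (lift_var f) \<rho> \<circ> lift_var g = lift_var (msubst f \<rho> \<circ> g)"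
  proof
    fix x show "(msubst (lift_var f) \<rho> \<circ> lift_var g) x = lift_var (msubst f \<rho> \<circ> g) x"
      using Lam.prems by (cases x rule: index_cases) (simp_all add: inc_var_msubst)
  qed
  moreover have "msubst (inc_mat 0 \<circ> f) (lift_index \<rho>) \<circ> (inc_mat 0 \<circ> g) = inc_mat 0 \<circ> (msubst f \<rho> \<circ> g)"
    using Lam.prems by (simp add: fun_eq_iff inc_mat_msubst)
  ultimately show ?case
    using Lam.prems
    by (simp only: msubst.simps inc_mat_Var lift_var_Var Lam.IH index_renaming_lift lift_index_comp)
qed (simp_all split: prod.split)

section \<open>Parallel reduction\<close>

text \<open>An unsubstituted \<open>Var 1 j\<close> becomes \<open>Var 0 j\<close>, which \<open>msubst\<close> never touches or captures; this makes
  contraction commute with \<open>msubst\<close> on arbitrary raw terms.\<close>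

fun beta_env :: "(nat \<rightharpoonup> pterm) \<Rightarrow> nat \<times> nat \<Rightarrow> pterm" where
  "beta_env \<theta> (0, j) = Var 0 j"
| "beta_env \<theta> (Suc 0, j) = (case \<theta> j of Some u \<Rightarrow> u | None \<Rightarrow> Var 0 j)"
| "beta_env \<theta> (Suc (Suc i), j) = Var (Suc i) j"

fun contract :: "matching \<Rightarrow> pterm \<Rightarrow> pterm" where
  "contract (Subst \<theta>) s = msubst (beta_env \<theta>) id s"
| "contract Fail s = Lam 1 (Mat 1 1) (Var 1 1)"
| "contract Wait s = s"

text \<open>The match is tested on the reducts, and without the increment of the argument: this increment would
  only be cancelled by the decrement after the substitution.\<close>

inductive par_red :: "pterm \<Rightarrow> pterm \<Rightarrow> bool" where
  Var: "par_red (Var i j) (Var i j)"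
| Mat: "par_red (Mat i j) (Mat i j)"
| App: "par_red t t' \<Longrightarrow> par_red u u' \<Longrightarrow> par_red (App t u) (App t' u')"
| Lam: "par_red p p' \<Longrightarrow> par_red s s' \<Longrightarrow> \<pi> permutes {1..n} \<Longrightarrow>
     par_red (Lam n p s) (Lam n (perm_mat 1 \<pi> p') (perm_var 1 \<pi> s'))"
| beta: "par_red p p' \<Longrightarrow> par_red s s' \<Longrightarrow> par_red u u' \<Longrightarrow> match n p' u' \<noteq> Wait \<Longrightarrow>
     par_red (App (Lam n p s) u) (contract (match n p' u') s')"

inductive_cases par_red_MatE: "par_red (Mat i j) t"
inductive_cases par_red_AppE: "par_red (App t u) v"
inductive_cases par_red_LamE: "par_red (Lam n p s) t"

lemma perm_var_id [simp]: "perm_var k id t = t"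
  by (induction t arbitrary: k) auto

lemma perm_mat_id [simp]: "perm_mat k id t = t"
  by (induction t arbitrary: k) auto

lemma perm_var_perm_var: "perm_var k \<pi> (perm_var k \<pi>' t) = perm_var k (\<pi> \<circ> \<pi>') t"
  by (induction t arbitrary: k) auto

lemma perm_mat_perm_mat: "perm_mat k \<pi> (perm_mat k \<pi>' t) = perm_mat k (\<pi> \<circ> \<pi>') t"
  by (induction t arbitrary: k) auto

lemma par_red_refl [simp]: "par_red t t"
proof (induction t)
  case (Lam n p s)
  then show ?case using par_red.Lam[OF Lam permutes_id, of n] by simp
qed (auto intro: par_red.intros)

lemma par_red_LamI: "par_red p p' \<Longrightarrow> par_red s s' \<Longrightarrow> par_red (Lam n p s) (Lam n p' s')"
  using par_red.Lam[OF _ _ permutes_id, of p p' s s' n] by simp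

section \<open>Stability of decided matches\<close>

text \<open>The matches compared have their bound secondary indices related by \<open>\<pi>\<close>.  A match that waits may
  become anything.\<close>

fun match_rel :: "(nat \<Rightarrow> nat) \<Rightarrow> (pterm \<Rightarrow> pterm \<Rightarrow> bool) \<Rightarrow> matching \<Rightarrow> matching \<Rightarrow> bool" where
  "match_rel \<pi> R (Subst \<theta>) \<nu> \<longleftrightarrow> (\<exists>\<theta>'. \<nu> = Subst \<theta>' \<and> (\<forall>j. rel_option R (\<theta> j) (\<theta>' (\<pi> j))))"
| "match_rel \<pi> R Fail \<nu> \<longleftrightarrow> \<nu> = Fail"
| "match_rel \<pi> R Wait \<nu> \<longleftrightarrow> True"

text \<open>The disjointness test of \<open>match_union\<close> and the final check of
  \<open>match\<close> look only at domains, so this is what transfers both.\<close>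

lemma match_rel_dom:
  assumes "bij \<pi>" "\<forall>j. rel_option R (\<theta> j) (\<theta>' (\<pi> j))"
  shows "dom \<theta>' = \<pi> ` dom \<theta>"
proof -
  have *: "\<pi> j \<in> dom \<theta>' \<longleftrightarrow> j \<in> dom \<theta>" for j
    using assms(2)[rule_format, of j] by (auto simp: option.rel_sel domIff)
  show ?thesis
  proof (intro set_eqI)
    fix i
    obtain j where "i = \<pi> j" using assms(1) by (meson bij_pointE)
    then show "i \<in> dom \<theta>' \<longleftrightarrow> i \<in> \<pi> ` dom \<theta>"
      using * assms(1) by (simp add: bij_is_inj inj_image_mem_iff)
  qed
qed

lemma match_rel_union:
  assumes "bij \<pi>" "match_rel \<pi> R \<mu> \<nu>" "match_rel \<pi> R \<mu>' \<nu>'"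
  shows "match_rel \<pi> R (match_union \<mu> \<mu>') (match_union \<nu> \<nu>')"
proof (cases "\<exists>\<theta> \<theta>'. \<mu> = Subst \<theta> \<and> \<mu>' = Subst \<theta>'")
  case True
  then obtain \<theta> \<theta>' \<sigma> \<sigma>' where eq: "\<mu> = Subst \<theta>" "\<mu>' = Subst \<theta>'" "\<nu> = Subst \<sigma>" "\<nu>' = Subst \<sigma>'"
    and R: "\<forall>j. rel_option R (\<theta> j) (\<sigma> (\<pi> j))" "\<forall>j. rel_option R (\<theta>' j) (\<sigma>' (\<pi> j))"
    using assms(2,3) by auto
  have "dom \<sigma> \<inter> dom \<sigma>' = \<pi> ` (dom \<theta> \<inter> dom \<theta>')"
    using match_rel_dom[OF assms(1) R(1)] match_rel_dom[OF assms(1) R(2)] assms(1)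
    by (simp add: bij_is_inj image_Int)
  moreover have "rel_option R ((\<theta> ++ \<theta>') j) ((\<sigma> ++ \<sigma>') (\<pi> j))" for j
    using R(1)[rule_format, of j] R(2)[rule_format, of j]
    by (cases "\<theta>' j") (auto simp: map_add_def elim: option.rel_cases)
  ultimately show ?thesis unfolding eq by auto
next
  case False
  \<comment> \<open>A failure dominates a wait, so a union with a waiting component is decided only
    by a failure on the other side, which persists whatever the wait becomes.\<close>
  then show ?thesis using assms(2,3) by (cases \<mu>; cases \<mu>'; cases \<nu>; cases \<nu>') auto
qed

text \<open>The check against \<open>{1..n}\<close> gives the same answer on both sides because
  \<open>\<pi>\<close> maps this set onto itself.\<close>

lemma match_rel_match:
  assumes \<pi>: "\<pi> permutes {1..n}" and rel: "match_rel \<pi> R (compound_match p u) (compound_match p' u')"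
  shows "match_rel \<pi> R (match n p u) (match n p' u')"
proof (cases "compound_match p u")
  case (Subst \<theta>)
  with rel obtain \<theta>' where \<theta>': "compound_match p' u' = Subst \<theta>'"
    and R: "\<forall>j. rel_option R (\<theta> j) (\<theta>' (\<pi> j))" by auto
  have "dom \<theta>' = {1..n} \<longleftrightarrow> dom \<theta> = {1..n}"
    using match_rel_dom[OF permutes_bij[OF \<pi>] R] permutes_image[OF \<pi>]
    by (metis \<pi> bij_is_inj inj_image_eq_iff permutes_bij)
  then show ?thesis using R Subst \<theta>' by (auto simp: match_def)
next
  case Fail
  with rel show ?thesis by (simp add: match_def)
next
  case Wait
  then show ?thesis by (simp add: match_def)
qed

section \<open>Stability of matches under substitution\<close>

lemma data_structure_msubst: "data_structure t \<Longrightarrow> data_structure (msubst f \<rho> t)"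
  by (induction t) (auto split: prod.split)

text \<open>The converse fails: replacing a variable at the head can create a matchable form, which
  is how a waiting match becomes decided.\<close>

lemma matchable_form_msubst: "matchable_form t \<Longrightarrow> matchable_form (msubst f \<rho> t)"
  by (auto simp: matchable_form_def data_structure_msubst)

lemma not_matchable_form_Var [simp]: "\<not> matchable_form (Var i j)"
  by (simp add: matchable_form_def)

lemma matchable_form_Mat [simp]: "matchable_form (Mat i j)"
  by (simp add: matchable_form_def)

lemma matchable_form_Lam [simp]: "matchable_form (Lam n p s)"
  by (simp add: matchable_form_def)

text \<open>This covers substitution below an abstraction (\<open>\<pi> = id\<close> and \<open>\<rho>' = lift_index \<rho>\<close>) as well as permutation of
  the indices bound by an abstraction (\<open>\<rho> = id\<close> and \<open>\<rho>' = perm_index 1 \<pi>\<close>).\<close>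

lemma compound_match_msubst:
  assumes \<rho>: "index_renaming \<rho>" and \<pi>: "bij \<pi>"
    and \<rho>': "\<And>j. \<rho>' (0, j) = (0, j)" "\<And>j. \<rho>' (Suc 0, j) = (Suc 0, \<pi> j)"
      "\<And>i j. \<rho>' (Suc (Suc i), j) = up 0 (\<rho> (Suc i, j))"
  shows "match_rel \<pi> (\<lambda>t t'. t' = msubst f \<rho> t)
    (compound_match p u) (compound_match (msubst g \<rho>' p) (msubst f \<rho> u))"
proof (induction p u rule: compound_match.induct)
  case (1 i j u)
  show ?case
  proof (cases "(i, j)" rule: index_cases)
    case zero
    then show ?thesis using \<rho>' matchable_form_msubst[of u f \<rho>] by auto
  next
    case one
    then show ?thesis using \<rho>' \<pi> by (auto simp: bij_is_inj inj_eq)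
  next
    case (Suc a b)
    obtain a' b' where ab: "\<rho> (Suc a, b) = (Suc a', b')" using \<rho> by (rule index_renaming_Suc)
    \<comment> \<open>A failed comparison of matchable indices stays failed by injectivity of
      \<open>\<rho>\<close>; applications and abstractions never become indices.\<close>
    have "msubst f \<rho> u \<noteq> Mat (Suc a') b'" if "matchable_form u" "u \<noteq> Mat (Suc a) b"
    proof (cases u)
      case (Mat c d)
      with that have "\<rho> (c, d) \<noteq> (Suc a', b')"
        using \<rho> unfolding index_renaming_def ab[symmetric] by (auto simp: inj_eq)
      then show ?thesis using Mat by (auto split: prod.split)
    qed (use that in auto)
    then show ?thesis using Suc \<rho>' ab matchable_form_msubst[of u f \<rho>] by auto
  qed
next
  case (2 p q t u)
  show ?case
  proof (cases "matchable_form (App p q) \<and> matchable_form (App t u)")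
    case True
    then have "matchable_form (msubst g \<rho>' (App p q))" "matchable_form (msubst f \<rho> (App t u))"
      by (simp_all only: matchable_form_msubst)
    then show ?thesis using True 2 match_rel_union[OF \<pi>] by simp
  qed auto
qed (use matchable_form_msubst in \<open>fastforce split: prod.split\<close>)+

text \<open>The head is a matchable index, so no redex lies along the spine and only the arguments
  change.\<close>

lemma par_red_data_structure: "par_red t t' \<Longrightarrow> data_structure t \<Longrightarrow> data_structure t'"
  by (induction rule: par_red.induct) auto

lemma par_red_matchable_form: "par_red t t' \<Longrightarrow> matchable_form t \<Longrightarrow> matchable_form t'"
  unfolding matchable_form_def using par_red_data_structure by (blast elim: par_red_LamE)

lemma par_red_matchable_App:
  assumes "par_red (App t u) v" "matchable_form (App t u)"
  obtains t' u' where "v = App t' u'" "par_red t t'" "par_red u u'"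
  using assms by (auto simp: matchable_form_def elim: par_red_AppE)

text \<open>A decision depends only on matchable indices and on shapes of matchable forms, which
  parallel steps preserve. The terms captured by the pattern are parts of \<open>u\<close> and
  reduce along with it.\<close>

lemma compound_match_par_red:
  "par_red p p' \<Longrightarrow> par_red u u' \<Longrightarrow> match_rel id par_red (compound_match p u) (compound_match p' u')"
proof (induction p u arbitrary: p' u' rule: compound_match.induct)
  case (1 i j u)
  then have p': "p' = Mat i j" by (auto elim: par_red_MatE)
  show ?case
  proof (cases "i = 1")
    case False
    have "u' \<noteq> Mat k l" if "matchable_form u" "u \<noteq> Mat k l" for k l
      using that \<open>par_red u u'\<close>
      by (cases u) (auto elim: par_red_MatE par_red_LamE par_red_matchable_App)
    moreover have "matchable_form u'" if "matchable_form u"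
      using that \<open>par_red u u'\<close> by (rule par_red_matchable_form[rotated])
    moreover have "u' = u" if "u = Mat k l" for k l
      using that \<open>par_red u u'\<close> by (auto elim: par_red_MatE)
    ultimately show ?thesis unfolding p' using False by auto
  qed (use 1 p' in auto)
next
  case (2 p q t u)
  show ?case
  proof (cases "matchable_form (App p q) \<and> matchable_form (App t u)")
    case True
    with 2 obtain r r' v v' where eq: "p' = App r v" "u' = App r' v'"
      and "par_red p r" "par_red q v" "par_red t r'" "par_red u v'"
      by (meson par_red_matchable_App)
    moreover have "matchable_form (App r v)" "matchable_form (App r' v')"
      using True 2 eq par_red_matchable_form by blast+
    ultimately show ?thesis using True 2 by (simp add: match_rel_union del: id_apply)
  qed auto
next
  case ("3_3" p q i j)
  show ?case
  proof (cases "matchable_form (App p q)")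
    case True
    with "3_3" obtain r v where "p' = App r v" by (meson par_red_matchable_App)
    moreover have "u' = Mat i j" using "3_3" by (auto elim: par_red_MatE)
    ultimately show ?thesis using True par_red_matchable_form[OF "3_3"(1)] by simp
  qed simp
next
  case ("3_4" p q n r s)
  show ?case
  proof (cases "matchable_form (App p q)")
    case True
    with "3_4" obtain r' v where "p' = App r' v" by (meson par_red_matchable_App)
    moreover obtain r'' s' where "u' = Lam n r'' s'" using "3_4" by (auto elim: par_red_LamE)
    ultimately show ?thesis using True par_red_matchable_form[OF "3_4"(1)] by simp
  qed simp
next
  case ("3_5" n p s u)
  then obtain r s' where "p' = Lam n r s'" by (auto elim: par_red_LamE)
  then show ?case using par_red_matchable_form[OF "3_5"(2)] by simp
qed simp_all

section \<open>The triangle property\<close>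

lemma perm_var_inc_var: "perm_var (Suc k) \<pi> (inc_var k t) = inc_var k t"
  by (induction t arbitrary: k) auto

lemma perm_mat_inc_mat: "perm_mat (Suc k) \<pi> (inc_mat k t) = inc_mat k t"
  by (induction t arbitrary: k) auto

text \<open>The permutation acts only on primary index 1, which \<open>lift_index \<rho>\<close>
  fixes and which does not occur free among the matchable indices of incremented terms.\<close>

lemma perm_mat_msubst:
  assumes \<rho>: "index_renaming \<rho>" and \<pi>: "bij \<pi>"
  shows "perm_mat 1 \<pi> (msubst (inc_mat 0 \<circ> f) (lift_index \<rho>) t) =
    msubst (inc_mat 0 \<circ> f) (lift_index \<rho>) (perm_mat 1 \<pi> t)"
proof -
  have \<rho>': "perm_index (Suc 0) \<pi> \<circ> lift_index \<rho> = lift_index \<rho> \<circ> perm_index (Suc 0) \<pi>" (is "?l = ?r")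
  proof
    fix x show "?l x = ?r x"
    proof (cases x rule: index_cases)
      case (Suc i j)
      then show ?thesis by (auto intro: index_renaming_Suc[OF \<rho>, of i j])
    qed simp_all
  qed
  have "rename id (perm_index (Suc 0) \<pi>) \<circ> (inc_mat 0 \<circ> f) = inc_mat 0 \<circ> f"
    using perm_mat_inc_mat[of 0 \<pi>] by (simp add: fun_eq_iff perm_mat_eq_rename)
  then have "perm_mat 1 \<pi> (msubst (inc_mat 0 \<circ> f) (lift_index \<rho>) t) =
      msubst (inc_mat 0 \<circ> f) (perm_index (Suc 0) \<pi> \<circ> lift_index \<rho>) t"
    using \<rho> \<pi> rename_msubst[of id "perm_index (Suc 0) \<pi>" "lift_index \<rho>" "inc_mat 0 \<circ> f" t]
    by (simp add: perm_mat_eq_rename del: comp_apply)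
  also have "\<dots> = msubst (inc_mat 0 \<circ> f) (lift_index \<rho>) (perm_mat 1 \<pi> t)"
    using \<rho> \<pi> msubst_rename[of id "lift_index \<rho>" "perm_index (Suc 0) \<pi>" "inc_mat 0 \<circ> f" t]
    by (simp add: perm_mat_eq_rename \<rho>' del: comp_apply)
  finally show ?thesis .
qed

lemma perm_var_msubst:
  assumes \<rho>: "index_renaming \<rho>" and \<pi>: "bij \<pi>"
  shows "perm_var 1 \<pi> (msubst (lift_var f) \<rho> t) = msubst (lift_var f) \<rho> (perm_var 1 \<pi> t)"
proof -
  have f: "rename (perm_index (Suc 0) \<pi>) id \<circ> lift_var f = lift_var f \<circ> perm_index (Suc 0) \<pi>"
    (is "?l = ?r")
  proof
    fix x show "?l x = ?r x"
      using perm_var_inc_var[of 0 \<pi>] by (cases x rule: index_cases) (simp_all add: perm_var_eq_rename)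
  qed
  show ?thesis
    using \<rho> \<pi> rename_msubst[of "perm_index (Suc 0) \<pi>" id \<rho> "lift_var f" t]
      msubst_rename[of "perm_index (Suc 0) \<pi>" \<rho> id "lift_var f" t]
    by (simp add: perm_var_eq_rename f del: comp_apply)
qed

text \<open>Substitution lemma for contraction: \<open>msubst_msubst\<close> turns both sides into
  one \<open>msubst\<close> of the body, and the environments are compared index by index.\<close>

lemma msubst_contract:
  assumes \<rho>: "index_renaming \<rho>" and rel: "match_rel id (\<lambda>t t'. t' = msubst f \<rho> t) \<mu> \<nu>" and "\<mu> \<noteq> Wait"
  shows "\<nu> \<noteq> Wait" and "msubst f \<rho> (contract \<mu> s) = contract \<nu> (msubst (lift_var f) \<rho> s)"
proof -
  show "\<nu> \<noteq> Wait" using assms by (cases \<mu>) auto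
  show "msubst f \<rho> (contract \<mu> s) = contract \<nu> (msubst (lift_var f) \<rho> s)"
  proof (cases \<mu>)
    case (Subst \<theta>)
    with rel obtain \<theta>' where \<nu>: "\<nu> = Subst \<theta>'"
      and \<theta>': "\<And>j. rel_option (\<lambda>t t'. t' = msubst f \<rho> t) (\<theta> j) (\<theta>' j)" by auto
    have "(msubst f \<rho> \<circ> beta_env \<theta>) x = (msubst (beta_env \<theta>') id \<circ> lift_var f) x" for x
    proof (cases x rule: index_cases)
      case (one j)
      with \<theta>'[of j] show ?thesis by (auto elim: option.rel_cases)
    next
      case (Suc i j)
      \<comment> \<open>A substituted term that was incremented for the binder loses the increment
        when the binder is contracted.\<close>
      have "msubst (beta_env \<theta>') id (inc_var 0 t) = t" for t
      proof -
        have "msubst (beta_env \<theta>') id (inc_var 0 t) = msubst (beta_env \<theta>' \<circ> up 0) (id \<circ> id) t"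
          unfolding inc_var_eq_rename by (rule msubst_rename) simp_all
        also have "\<dots> = msubst (case_prod Var) id t" by (simp add: msubst_cong del: msubst_id)
        finally show ?thesis by simp
      qed
      then show ?thesis using Suc by simp
    qed simp
    then have "msubst f \<rho> \<circ> beta_env \<theta> = msubst (beta_env \<theta>') id \<circ> lift_var f" ..
    then show ?thesis
      using \<rho> msubst_msubst[of \<rho> id f "beta_env \<theta>" s]
        msubst_msubst[of id \<rho> "beta_env \<theta>'" "lift_var f" s] Subst \<nu>
      by (simp del: comp_apply)
  qed (use assms in auto)
qed

text \<open>Applied first to pairs of equal renamings and then, since increments are renamings, to pointwise
  parallel reduction of the substituted terms.\<close>

lemma par_red_msubst_closed:
  assumes lift_var: "\<And>f f'. P f f' \<Longrightarrow> P (lift_var f) (lift_var f')"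
    and inc_mat: "\<And>f f'. P f f' \<Longrightarrow> P (inc_mat 0 \<circ> f) (inc_mat 0 \<circ> f')"
    and P: "\<And>f f' x. P f f' \<Longrightarrow> par_red (f x) (f' x)"
  shows "par_red t t' \<Longrightarrow> P f f' \<Longrightarrow> index_renaming \<rho> \<Longrightarrow> par_red (msubst f \<rho> t) (msubst f' \<rho> t')"
proof (induction arbitrary: f f' \<rho> rule: par_red.induct)
  case (Var i j)
  then show ?case using P by simp
next
  case (Mat i j)
  then show ?case by simp
next
  case (App t t' u u')
  show ?case unfolding msubst.simps
    by (intro par_red.App App.IH App.prems)
next
  case (Lam p p' s s' \<pi> n)
  have "par_red (Lam n (msubst (inc_mat 0 \<circ> f) (lift_index \<rho>) p) (msubst (lift_var f) \<rho> s))
    (Lam n (perm_mat 1 \<pi> (msubst (inc_mat 0 \<circ> f') (lift_index \<rho>) p'))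
      (perm_var 1 \<pi> (msubst (lift_var f') \<rho> s')))"
    by (intro par_red.Lam Lam.IH Lam.hyps lift_var inc_mat Lam.prems index_renaming_lift)
  then show ?case
    unfolding perm_mat_msubst[OF Lam.prems(2) permutes_bij[OF Lam.hyps(3)]]
      perm_var_msubst[OF Lam.prems(2) permutes_bij[OF Lam.hyps(3)]] msubst.simps .
next
  case (beta p p' s s' u u' n)
  let ?p = "msubst (inc_mat 0 \<circ> f') (lift_index \<rho>) p'" and ?u = "msubst f' \<rho> u'"
  have "match_rel id (\<lambda>t t'. t' = msubst f' \<rho> t) (match n p' u') (match n ?p ?u)"
    using beta.prems by (intro match_rel_match permutes_id compound_match_msubst) simp_all
  note rel = msubst_contract[OF beta.prems(2) this beta.hyps(4)]
  show ?case unfolding rel(2) msubst.simps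
    by (intro par_red.beta beta.IH beta.prems lift_var inc_mat index_renaming_lift rel(1))
qed

lemma par_red_rename:
  assumes "par_red t t'" "index_renaming \<rho>"
  shows "par_red (rename \<alpha> \<rho> t) (rename \<alpha> \<rho> t')"
  by (rule par_red_msubst_closed[where P = "\<lambda>f f'. f' = f \<and> (\<exists>\<alpha>. f = case_prod Var \<circ> \<alpha>)"])
    (use assms in auto)

lemma par_red_msubst:
  assumes "par_red t t'" "\<And>x. par_red (f x) (f' x)" "index_renaming \<rho>"
  shows "par_red (msubst f \<rho> t) (msubst f' \<rho> t')"
proof (rule par_red_msubst_closed[where P = "\<lambda>f f'. \<forall>x. par_red (f x) (f' x)"])
  fix f f' :: "nat \<times> nat \<Rightarrow> pterm"
  assume *: "\<forall>x. par_red (f x) (f' x)"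
  show "\<forall>x. par_red (lift_var f x) (lift_var f' x)"
  proof
    fix x show "par_red (lift_var f x) (lift_var f' x)"
      using * by (cases x rule: index_cases) (simp_all add: inc_var_eq_rename par_red_rename)
  qed
  show "\<forall>x. par_red ((inc_mat 0 \<circ> f) x) ((inc_mat 0 \<circ> f') x)"
    using * par_red_rename[where \<alpha> = id] by (simp add: inc_mat_eq_rename)
qed (use assms in auto)

lemma par_red_perm_mat:
  "par_red t t' \<Longrightarrow> bij \<pi> \<Longrightarrow> par_red (perm_mat 1 \<pi> t) (perm_mat 1 \<pi> t')"
  using par_red_rename[of t t' "perm_index 1 \<pi>" id] by (simp add: perm_mat_eq_rename)

lemma par_red_perm_var:
  "par_red t t' \<Longrightarrow> bij \<pi> \<Longrightarrow> par_red (perm_var 1 \<pi> t) (perm_var 1 \<pi> t')"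
  using par_red_rename[of t t' id "perm_index 1 \<pi>"] by (simp add: perm_var_eq_rename)

lemma par_red_contract:
  assumes rel: "match_rel id par_red \<mu> \<nu>" and "\<mu> \<noteq> Wait" and s: "par_red s s'"
  shows "\<nu> \<noteq> Wait" and "par_red (contract \<mu> s) (contract \<nu> s')"
proof -
  show "\<nu> \<noteq> Wait" using assms by (cases \<mu>) auto
  show "par_red (contract \<mu> s) (contract \<nu> s')"
  proof (cases \<mu>)
    case (Subst \<theta>)
    with rel obtain \<theta>' where \<nu>: "\<nu> = Subst \<theta>'"
      and \<theta>': "\<And>j. rel_option par_red (\<theta> j) (\<theta>' j)" by auto
    have "par_red (beta_env \<theta> x) (beta_env \<theta>' x)" for x
    proof (cases x rule: index_cases)
      case (one j)
      with \<theta>'[of j] show ?thesis by (auto elim: option.rel_cases)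
    qed simp_all
    with s show ?thesis unfolding Subst \<nu> by (simp add: par_red_msubst)
  qed (use assms in auto)
qed

lemma match_dom: "match n p u = Subst \<theta> \<Longrightarrow> dom \<theta> = {1..n}"
  by (auto simp: match_def split: matching.splits if_splits)

text \<open>The contractum does not depend on the representative of the abstraction: the match is
  reindexed by \<open>\<pi>\<close>, and the permuted body looks it up accordingly.\<close>

lemma contract_perm:
  assumes \<pi>: "\<pi> permutes {1..n}" and "match n p u \<noteq> Wait"
  shows "match n (perm_mat 1 \<pi> p) u \<noteq> Wait"
    and "contract (match n (perm_mat 1 \<pi> p) u) (perm_var 1 \<pi> s) = contract (match n p u) s"
proof -
  have "match_rel \<pi> (\<lambda>t t'. t' = msubst (case_prod Var) id t) (compound_match p u)
      (compound_match (msubst (case_prod Var) (perm_index 1 \<pi>) p) (msubst (case_prod Var) id u))"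
    by (rule compound_match_msubst) (simp_all add: permutes_bij[OF \<pi>])
  then have "match_rel \<pi> (\<lambda>t t'. t' = t) (compound_match p u) (compound_match (perm_mat 1 \<pi> p) u)"
    by (simp add: perm_mat_eq_rename)
  then have rel: "match_rel \<pi> (\<lambda>t t'. t' = t) (match n p u) (match n (perm_mat 1 \<pi> p) u)"
    by (rule match_rel_match[OF \<pi>])
  then show "match n (perm_mat 1 \<pi> p) u \<noteq> Wait" using assms(2) by (cases "match n p u") auto
  show "contract (match n (perm_mat 1 \<pi> p) u) (perm_var 1 \<pi> s) = contract (match n p u) s"
  proof (cases "match n p u")
    case (Subst \<theta>)
    with rel obtain \<theta>' where \<theta>': "match n (perm_mat 1 \<pi> p) u = Subst \<theta>'"
      and eq: "\<And>j. rel_option (\<lambda>t t'. t' = t) (\<theta> j) (\<theta>' (\<pi> j))" by auto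
    have dom: "dom \<theta> = {1..n}" using Subst by (rule match_dom)
    have "(beta_env \<theta>' \<circ> perm_index 1 \<pi>) x = beta_env \<theta> x" for x
    proof (cases x rule: index_cases)
      case (one j)
      show ?thesis
      proof (cases "\<theta> j")
        case None
        \<comment> \<open>Outside the domain \<open>\<pi>\<close> is the identity, so both
          environments yield the same \<open>Var 0 j\<close>.\<close>
        then have "j \<notin> {1..n}" using dom by (metis domIff)
        then have "\<pi> j = j" using \<pi> by (metis permutes_not_in)
        then show ?thesis using one eq[of j] None by simp
      next
        case (Some t)
        then show ?thesis using one eq[of j] by (auto elim: option.rel_cases)
      qed
    qed simp_all
    then have "beta_env \<theta>' \<circ> perm_index 1 \<pi> = beta_env \<theta>" ..
    then show ?thesis
      using Subst \<theta>' msubst_rename[of "perm_index 1 \<pi>" id id "beta_env \<theta>'" s] permutes_bij[OF \<pi>]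
      by (simp add: perm_var_eq_rename del: comp_apply)
  qed (use assms rel in auto)
qed

text \<open>Complete development: it contracts every redex whose match is decided after developing
  its parts. It applies no permutation, since the one made by a parallel step can be undone by the
  next.\<close>

fun develop :: "pterm \<Rightarrow> pterm" where
  "develop (Var i j) = Var i j"
| "develop (Mat i j) = Mat i j"
| "develop (App (Lam n p s) u) =
     (if match n (develop p) (develop u) = Wait
      then App (Lam n (develop p) (develop s)) (develop u)
      else contract (match n (develop p) (develop u)) (develop s))"
| "develop (App t u) = App (develop t) (develop u)"
| "develop (Lam n p s) = Lam n (develop p) (develop s)"

lemma par_red_develop: "par_red t t' \<Longrightarrow> par_red t' (develop t)"
proof (induction rule: par_red.induct)
  case (App t t' u u')
  show ?case
  proof (cases "\<exists>n p s. t = Lam n p s \<and> match n (develop p) (develop u) \<noteq> Wait")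
    case True
    then obtain n p s where t: "t = Lam n p s" and match: "match n (develop p) (develop u) \<noteq> Wait"
      by blast
    obtain p' s' where t': "t' = Lam n p' s'" using App.hyps(1) t by (auto elim: par_red_LamE)
    have "par_red (Lam n p' s') (Lam n (develop p) (develop s))" using App.IH(1) t t' by simp
    then obtain q r \<pi> where q: "par_red p' q" "par_red s' r" and \<pi>: "\<pi> permutes {1..n}"
      and dev: "develop p = perm_mat 1 \<pi> q" "develop s = perm_var 1 \<pi> r"
      by (auto elim: par_red_LamE)
    \<comment> \<open>The reducts \<open>q\<close> and \<open>r\<close> are the developed pattern
      and body before permutation; by \<open>contract_perm\<close>, contracting with them gives the
      contractum chosen by \<open>develop\<close>.\<close>
    have inv: "perm_mat 1 (inv \<pi>) (develop p) = q" "perm_var 1 (inv \<pi>) (develop s) = r"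
      using permutes_inv_o[OF \<pi>] by (simp_all add: dev perm_mat_perm_mat perm_var_perm_var)
    note contract = contract_perm[OF permutes_inv[OF \<pi>] match, unfolded inv]
    have "par_red (App (Lam n p' s') u') (contract (match n q (develop u)) r)"
      using q App.IH(2) contract(1) by (rule par_red.beta)
    also have "contract (match n q (develop u)) r = contract (match n (develop p) (develop u)) (develop s)"
      using contract(2)[of "develop s"] unfolding inv .
    finally show ?thesis using t t' match by simp
  next
    case False
    then have "develop (App t u) = App (develop t) (develop u)" by (cases t) auto
    then show ?thesis using App.IH by (simp add: par_red.App)
  qed
next
  case (Lam p p' s s' \<pi> n)
  \<comment> \<open>The step to the development carries \<open>inv \<pi>\<close>, which cancels the
    permutation of the given step.\<close>
  have "par_red (Lam n (perm_mat 1 \<pi> p') (perm_var 1 \<pi> s'))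
    (Lam n (perm_mat 1 (inv \<pi>) (perm_mat 1 \<pi> (develop p)))
      (perm_var 1 (inv \<pi>) (perm_var 1 \<pi> (develop s))))"
    using Lam permutes_bij
    by (intro par_red.Lam par_red_perm_mat par_red_perm_var permutes_inv) auto
  then show ?case
    using permutes_inv_o[OF Lam.hyps(3)] by (simp add: perm_mat_perm_mat perm_var_perm_var)
next
  case (beta p p' s s' u u' n)
  have "match_rel id par_red (match n p' u') (match n (develop p) (develop u))"
    using beta.IH by (intro match_rel_match permutes_id compound_match_par_red)
  then show ?case using par_red_contract[OF _ beta.hyps(4) beta.IH(2)] by simp
qed simp_all

text \<open>All one-step reducts of a term meet in its development after one further step.\<close>

lemma confluentp_par_red: "confluentp par_red"
  by (intro strong_confluentp_imp_confluentp strong_confluentpI) (blast dest: par_red_develop)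

section \<open>Reduction steps as contractions\<close>

fun map_matching :: "(pterm \<Rightarrow> pterm) \<Rightarrow> matching \<Rightarrow> matching" where
  "map_matching f (Subst \<theta>) = Subst (map_option f \<circ> \<theta>)"
| "map_matching f Fail = Fail"
| "map_matching f Wait = Wait"

lemma match_union_map_matching:
  "match_union (map_matching f \<mu>) (map_matching f \<nu>) = map_matching f (match_union \<mu> \<nu>)"
  by (cases \<mu>; cases \<nu>) (auto simp: dom_map_option_comp fun_eq_iff map_add_def split: option.split)

lemma matchable_form_inc_var: "matchable_form (inc_var k t) = matchable_form t"
proof -
  have "data_structure (inc_var k t) = data_structure t" by (induction t) auto
  then show ?thesis by (cases t) (auto simp: matchable_form_def)
qed

text \<open>Matching looks at shapes and matchable indices of the argument, which an increment of
  variable indices leaves alone.\<close>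

lemma compound_match_inc_var:
  "compound_match p (inc_var k u) = map_matching (inc_var k) (compound_match p u)"
proof (induction p u rule: compound_match.induct)
  case (1 i j u)
  have "inc_var k u = Mat a b \<longleftrightarrow> u = Mat a b" for a b by (cases u) auto
  then show ?case by (auto simp: matchable_form_inc_var fun_eq_iff)
next
  case (2 p q t u)
  then show ?case
    using matchable_form_inc_var[of k "App t u"] by (auto simp: match_union_map_matching)
qed (use matchable_form_inc_var[of k] in \<open>auto simp: matchable_form_def\<close>)

lemma match_inc_var: "match n p (inc_var k u) = map_matching (inc_var k) (match n p u)"
  by (cases "compound_match p u")
    (auto simp: match_def compound_match_inc_var dom_map_option_comp)

text \<open>\<open>beta_env\<close> seen below \<open>k\<close> binders, whose own indices are kept;
  the induction in \<open>dec_var_subst\<close> needs this depth.\<close>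

fun beta_env_at :: "nat \<Rightarrow> (nat \<rightharpoonup> pterm) \<Rightarrow> nat \<times> nat \<Rightarrow> pterm" where
  "beta_env_at k \<theta> (i, j) =
     (if i \<le> k then Var i j
      else if i = Suc k then (case \<theta> j of Some u \<Rightarrow> u | None \<Rightarrow> Var 0 j)
      else Var (i - 1) j)"

lemma beta_env_at_0: "beta_env_at 0 \<theta> = beta_env \<theta>"
  by (rule ext, rule_tac x = x in index_cases) auto

lemma dec_var_inc_var: "dec_var k (inc_var k t) = t"
  by (induction t arbitrary: k) auto

lemma inc_var_inc_var: "inc_var (Suc k) (inc_var 0 t) = inc_var 0 (inc_var k t)"
  using inc_var_rename[of "up k" id t] by (simp add: inc_var_eq_rename)

lemma inc_var_inc_mat: "inc_var k (inc_mat l t) = inc_mat l (inc_var k t)"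
  by (induction t arbitrary: k l) auto

text \<open>The decrement cancels the increment of the substituted terms. The hypothesis rules out
  an unsubstituted \<open>Var (Suc k) j\<close>, which \<open>dec_var\<close> would lower to
  \<open>Var k j\<close>, a bound index for positive \<open>k\<close>, while the environment gives
  \<open>Var 0 j\<close>.\<close>

lemma dec_var_subst:
  "(\<And>j. (Suc k, j) \<in> fv s \<Longrightarrow> j \<in> dom \<sigma>) \<Longrightarrow>
    dec_var k (subst (Suc k) (map_option (inc_var k) \<circ> \<sigma>) s) = msubst (beta_env_at k \<sigma>) id s"
proof (induction s arbitrary: k \<sigma>)
  case (Var i j)
  then show ?case by (auto simp: dec_var_inc_var split: option.split)
next
  case (Lam n p s)
  \<comment> \<open>Commuting the increments puts \<open>inc_var k\<close> outermost again, as the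
    induction hypotheses require.\<close>
  have p: "map_option (inc_mat 0) \<circ> (map_option (inc_var k) \<circ> \<sigma>) =
      map_option (inc_var k) \<circ> (map_option (inc_mat 0) \<circ> \<sigma>)"
    and s: "map_option (inc_var 0) \<circ> (map_option (inc_var k) \<circ> \<sigma>) =
      map_option (inc_var (Suc k)) \<circ> (map_option (inc_var 0) \<circ> \<sigma>)"
    by (simp_all add: fun_eq_iff option.map_comp comp_def inc_var_inc_mat inc_var_inc_var)
  have p': "inc_mat 0 \<circ> beta_env_at k \<sigma> = beta_env_at k (map_option (inc_mat 0) \<circ> \<sigma>)"
    by (auto simp: fun_eq_iff split: option.split)
  have "lift_var (beta_env_at k \<sigma>) x = beta_env_at (Suc k) (map_option (inc_var 0) \<circ> \<sigma>) x" for x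
    by (cases x rule: index_cases) (auto split: option.split)
  then have s': "lift_var (beta_env_at k \<sigma>) = beta_env_at (Suc k) (map_option (inc_var 0) \<circ> \<sigma>)" ..
  have "dec_var k (subst (Suc k) (map_option (inc_var k) \<circ> (map_option (inc_mat 0) \<circ> \<sigma>)) p) =
      msubst (beta_env_at k (map_option (inc_mat 0) \<circ> \<sigma>)) id p"
    using Lam.prems by (intro Lam.IH) (simp_all add: dom_map_option)
  moreover have "dec_var (Suc k) (subst (Suc (Suc k)) (map_option (inc_var (Suc k)) \<circ> (map_option (inc_var 0) \<circ> \<sigma>)) s) =
      msubst (beta_env_at (Suc k) (map_option (inc_var 0) \<circ> \<sigma>)) id s"
    using Lam.prems by (intro Lam.IH) (simp_all add: dom_map_option)
  ultimately show ?case
    by (simp only: msubst.simps subst.simps dec_var.simps p s p' s' lift_index_id Suc_eq_plus1)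
qed auto

lemma well_formed_fv: "well_formed t \<Longrightarrow> (i, j) \<in> fv t \<Longrightarrow> 1 \<le> i \<and> 1 \<le> j"
  by (induction t arbitrary: i) auto

text \<open>Well-formedness confines the secondary indices bound in \<open>s\<close> to
  \<open>{1..n}\<close>, exactly the domain of a successful match.\<close>

lemma dec_var_apply_match:
  assumes "well_formed (Lam n p s)" "match n p u \<noteq> Wait"
  shows "dec_var 0 (apply_match (match n p (inc_var 0 u)) s) = contract (match n p u) s"
proof (cases "match n p u")
  case (Subst \<theta>)
  have "j \<in> dom \<theta>" if "(Suc 0, j) \<in> fv s" for j
    using assms(1) that match_dom[OF Subst] well_formed_fv[of s "Suc 0" j] by auto
  then show ?thesis
    using dec_var_subst[of 0 s \<theta>] Subst by (simp add: match_inc_var beta_env_at_0)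
qed (use assms in \<open>auto simp: match_inc_var\<close>)

section \<open>Preservation of well-formedness\<close>

lemma fm_inc_var [simp]: "fm (inc_var k t) = fm t"
  by (induction t arbitrary: k) auto

lemma fv_inc_mat [simp]: "fv (inc_mat k t) = fv t"
  by (induction t arbitrary: k) auto

lemma fv_inc_var: "(i, j) \<in> fv (inc_var k t) \<Longrightarrow> \<exists>i'. (i', j) \<in> fv t \<and> up k (i', j) = (i, j)"
proof (induction t arbitrary: k i)
  case (Lam n p s)
  show ?case
  proof (cases "(i, j) \<in> fv (inc_var k p)")
    case True
    then show ?thesis using Lam.IH(1) by fastforce
  next
    case False
    with Lam.prems have "1 \<le> i" "(i + 1, j) \<in> fv (inc_var (k + 1) s)" by auto
    with Lam.IH(2) obtain i' where "(i', j) \<in> fv s" "up (k + 1) (i', j) = (i + 1, j)" by blast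
    \<comment> \<open>A free index of the abstraction is one below the corresponding index of its
      body.\<close>
    then show ?thesis using \<open>1 \<le> i\<close> by (intro exI[of _ "i' - 1"]) (auto split: if_splits)
  qed
qed (fastforce split: if_splits)+

lemma fm_inc_mat: "(i, j) \<in> fm (inc_mat k t) \<Longrightarrow> \<exists>i'. (i', j) \<in> fm t \<and> up k (i', j) = (i, j)"
proof (induction t arbitrary: k i)
  case (Lam n p s)
  show ?case
  proof (cases "(i, j) \<in> fm (inc_mat k s)")
    case True
    then show ?thesis using Lam.IH(2) by fastforce
  next
    case False
    with Lam.prems have "1 \<le> i" "(i + 1, j) \<in> fm (inc_mat (k + 1) p)" by auto
    with Lam.IH(1) obtain i' where "(i', j) \<in> fm p" "up (k + 1) (i', j) = (i + 1, j)" by blast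
    then show ?thesis using \<open>1 \<le> i\<close> by (intro exI[of _ "i' - 1"]) (auto split: if_splits)
  qed
qed (fastforce split: if_splits)+

lemma fv_inc_var_Suc: "(Suc i, j) \<in> fv (inc_var 0 t) \<Longrightarrow> (i, j) \<in> fv t \<and> i \<noteq> 0"
  by (drule fv_inc_var) (auto split: if_splits)

lemma fm_inc_mat_Suc: "(Suc i, j) \<in> fm (inc_mat 0 t) \<Longrightarrow> (i, j) \<in> fm t \<and> i \<noteq> 0"
  by (drule fm_inc_mat) (auto split: if_splits)

lemma well_formed_inc_var: "well_formed t \<Longrightarrow> well_formed (inc_var k t)"
proof (induction t arbitrary: k)
  case (Lam n p s)
  have "j \<le> n" if "(1, j) \<in> fv (inc_var (k + 1) s)" for j
    using fv_inc_var[OF that] Lam.prems by (auto split: if_splits)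
  then show ?case using Lam by auto
qed auto

lemma well_formed_inc_mat: "well_formed t \<Longrightarrow> well_formed (inc_mat k t)"
proof (induction t arbitrary: k)
  case (Lam n p s)
  have "j \<le> n" if "(1, j) \<in> fm (inc_mat (k + 1) p)" for j
    using fm_inc_mat[OF that] Lam.prems by (auto split: if_splits)
  then show ?case using Lam by auto
qed auto

text \<open>Well-formedness excludes \<open>Var 0 j\<close>, which \<open>msubst\<close> keeps
  whatever \<open>f\<close> is.\<close>

lemma fv_msubst:
  "well_formed t \<Longrightarrow> x \<in> fv (msubst f \<rho> t) \<Longrightarrow> \<exists>y\<in>fv t. x \<in> fv (f y)"
proof (induction t arbitrary: f \<rho> x)
  case (Mat i j)
  then show ?case by (simp split: prod.splits)
next
  case (App t u)
  show ?case using App.IH[of x f \<rho>] App.prems by auto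
next
  case (Lam n p s)
  show ?case
  proof (cases "x \<in> fv (msubst (inc_mat 0 \<circ> f) (lift_index \<rho>) p)")
    case True
    have "\<exists>y\<in>fv p. x \<in> fv ((inc_mat 0 \<circ> f) y)"
      by (rule Lam.IH(1)[OF _ True]) (use Lam.prems in simp)
    then show ?thesis by auto
  next
    case False
    with Lam.prems obtain i j where x: "x = (i, j)" "1 \<le> i"
      and "(Suc i, j) \<in> fv (msubst (lift_var f) \<rho> s)" by auto
    with Lam.IH(2)[of "(Suc i, j)" "lift_var f" \<rho>] Lam.prems
    obtain y where y: "y \<in> fv s" "(Suc i, j) \<in> fv (lift_var f y)" by auto
    then show ?thesis using x
      by (cases y rule: index_cases) (auto dest!: fv_inc_var_Suc)
  qed
qed auto

lemma fm_msubst: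
  "well_formed t \<Longrightarrow> x \<in> fm (msubst f \<rho> t) \<Longrightarrow> x \<in> \<rho> ` fm t \<or> (\<exists>y\<in>fv t. x \<in> fm (f y))"
proof (induction t arbitrary: f \<rho> x)
  case (Mat i j)
  then show ?case by (auto split: prod.splits)
next
  case (App t u)
  show ?case using App.IH[of x f \<rho>] App.prems by auto
next
  case (Lam n p s)
  show ?case
  proof (cases "x \<in> fm (msubst (lift_var f) \<rho> s)")
    case True
    with Lam.IH(2)[of x "lift_var f" \<rho>] Lam.prems
    consider "x \<in> \<rho> ` fm s" | y where "y \<in> fv s" "x \<in> fm (lift_var f y)" by auto
    then show ?thesis
    proof cases
      case (2 y)
      then show ?thesis by (cases y rule: index_cases) auto
    qed auto
  next
    case False
    with Lam.prems obtain i j where x: "x = (i, j)" "1 \<le> i"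
      and ij: "(Suc i, j) \<in> fm (msubst (inc_mat 0 \<circ> f) (lift_index \<rho>) p)" by auto
    have "(Suc i, j) \<in> lift_index \<rho> ` fm p \<or> (\<exists>y\<in>fv p. (Suc i, j) \<in> fm ((inc_mat 0 \<circ> f) y))"
      by (rule Lam.IH(1)[OF _ ij]) (use Lam.prems in simp)
    then consider y where "y \<in> fm p" "(Suc i, j) = lift_index \<rho> y"
      | y where "y \<in> fv p" "(Suc i, j) \<in> fm (inc_mat 0 (f y))" by auto
    then show ?thesis
    proof cases
      case (1 y)
      show ?thesis
      proof (cases y rule: index_cases)
        case (Suc a b)
        with 1 have "up 0 (\<rho> (Suc a, b)) = (Suc i, j)" by simp
        then have "\<rho> (Suc a, b) = (i, j)" by (cases "\<rho> (Suc a, b)") (auto split: if_splits)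
        moreover have "(Suc a, b) \<in> fm (Lam n p s)" using 1 Suc by simp
        ultimately show ?thesis unfolding x by (metis image_eqI)
      qed (use 1 x in auto)
    next
      case (2 y)
      then have "(i, j) \<in> fm (f y)" using fm_inc_mat_Suc by blast
      with 2 x show ?thesis by auto
    qed
  qed
qed auto

text \<open>The range conditions survive because terms inserted under a binder are incremented and
  thus contribute no index bound by it.\<close>

lemma well_formed_msubst:
  assumes "index_renaming \<rho>" "\<And>i j. 1 \<le> j \<Longrightarrow> 1 \<le> snd (\<rho> (i, j))"
    and "well_formed t" "\<And>y. y \<in> fv t \<Longrightarrow> well_formed (f y)"
  shows "well_formed (msubst f \<rho> t)"
  using assms
proof (induction t arbitrary: f \<rho>)
  case (Mat i j)
  then obtain i' where i: "i = Suc i'" by (cases i) auto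
  obtain a b where ab: "\<rho> (Suc i', j) = (Suc a, b)"
    using Mat.prems(1) by (rule index_renaming_Suc)
  then show ?case using i Mat.prems(2)[of j i] Mat.prems(3) by simp
next
  case (Lam n p s)
  have "1 \<le> snd (lift_index \<rho> (i, j))" if "1 \<le> j" for i j
  proof (cases "(i, j)" rule: index_cases)
    case (Suc a b)
    then show ?thesis using that Lam.prems(2)[of b "Suc a"] by (cases "\<rho> (Suc a, b)") auto
  qed (use that in auto)
  then have "well_formed (msubst (inc_mat 0 \<circ> f) (lift_index \<rho>) p)"
    using Lam.prems by (intro Lam.IH) (auto intro: well_formed_inc_mat)
  moreover have "well_formed (lift_var f y)" if "y \<in> fv s" for y
    using that Lam.prems well_formed_fv[of s]
    by (cases y rule: index_cases) (fastforce intro: well_formed_inc_var)+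
  then have "well_formed (msubst (lift_var f) \<rho> s)"
    using Lam.prems by (intro Lam.IH) auto
  moreover have "j \<le> n" if j: "(1, j) \<in> fv (msubst (lift_var f) \<rho> s)" for j
  proof -
    obtain y where "y \<in> fv s" "(1, j) \<in> fv (lift_var f y)"
      using fv_msubst[OF _ j] Lam.prems by auto
    then show ?thesis
      using Lam.prems by (cases y rule: index_cases) (auto dest: fv_inc_var_Suc)
  qed
  moreover have "j \<le> n" if j: "(1, j) \<in> fm (msubst (inc_mat 0 \<circ> f) (lift_index \<rho>) p)" for j
  proof -
    consider y where "y \<in> fm p" "(1, j) = lift_index \<rho> y"
      | y where "(Suc 0, j) \<in> fm (inc_mat 0 (f y))"
      using fm_msubst[OF _ j] Lam.prems by auto
    then show ?thesis
    proof cases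
      case (1 y)
      show ?thesis
      proof (cases y rule: index_cases)
        case (Suc a b)
        with 1 have "up 0 (\<rho> (Suc a, b)) = (Suc 0, j)" by simp
        then have "fst (\<rho> (Suc a, b)) = 0" by (cases "\<rho> (Suc a, b)") (auto split: if_splits)
        then show ?thesis using Lam.prems(1) by (simp add: index_renaming_def)
      qed (use 1 Lam.prems in auto)
    qed (use fm_inc_mat_Suc in blast)
  qed
  ultimately show ?case by simp
qed auto

section \<open>Invariants of contraction and of permutation\<close>

lemma match_union_Subst:
  assumes "match_union \<mu> \<nu> = Subst \<theta>"
  obtains \<sigma> \<tau> where "\<mu> = Subst \<sigma>" "\<nu> = Subst \<tau>" "\<theta> = \<sigma> ++ \<tau>"
  using assms by (cases \<mu>; cases \<nu>) (auto split: if_splits)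

text \<open>Matching descends through applications only, so a captured term is a subterm of the
  argument under no binder.\<close>

lemma compound_match_component:
  "compound_match p u = Subst \<theta> \<Longrightarrow> \<theta> j = Some v \<Longrightarrow>
    (well_formed u \<longrightarrow> well_formed v) \<and> fv v \<subseteq> fv u \<and> fm v \<subseteq> fm u"
proof (induction p u arbitrary: \<theta> rule: compound_match.induct)
  case (1 i j u)
  then show ?case by (auto split: if_splits)
next
  case (2 p q t u)
  then have m: "matchable_form (App p q) \<and> matchable_form (App t u)"
    and "match_union (compound_match p t) (compound_match q u) = Subst \<theta>"
    by (auto split: if_splits)
  then obtain \<sigma> \<tau> where "compound_match p t = Subst \<sigma>" "compound_match q u = Subst \<tau>"
    and \<theta>: "\<theta> = \<sigma> ++ \<tau>" by (elim match_union_Subst)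
  note IH = 2(1)[OF m this(1)] 2(2)[OF m this(2)]
  from 2(4) \<theta> consider "\<tau> j = Some v" | "\<sigma> j = Some v" by (auto simp: map_add_Some_iff)
  then show ?case by cases (use IH in fastforce)+
qed (auto split: if_splits)

lemma match_component:
  assumes "match n p u = Subst \<theta>" "\<theta> j = Some v"
  shows "(well_formed u \<longrightarrow> well_formed v) \<and> fv v \<subseteq> fv u \<and> fm v \<subseteq> fm u"
  using assms by (intro compound_match_component[of p u \<theta>])
    (auto simp: match_def split: matching.splits if_splits)

lemma contract_invariants:
  assumes wf: "well_formed (Lam n p s)" "well_formed u" and "match n p u \<noteq> Wait"
  shows "well_formed (contract (match n p u) s)"
    and "fv (contract (match n p u) s) \<subseteq> fv (App (Lam n p s) u)"
    and "fm (contract (match n p u) s) \<subseteq> fm (App (Lam n p s) u)"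
proof -
  have "well_formed (contract (match n p u) s) \<and>
    fv (contract (match n p u) s) \<subseteq> fv (App (Lam n p s) u) \<and>
    fm (contract (match n p u) s) \<subseteq> fm (App (Lam n p s) u)"
  proof (cases "match n p u")
    case (Subst \<theta>)
    have env: "well_formed (beta_env \<theta> y) \<and> fv (beta_env \<theta> y) \<subseteq> fv (App (Lam n p s) u) \<and>
        fm (beta_env \<theta> y) \<subseteq> fm u" if y: "y \<in> fv s" for y
    proof (cases y rule: index_cases)
      case (zero j)
      then show ?thesis using well_formed_fv[of s 0 j] wf y by auto
    next
      case (one j)
      with y wf well_formed_fv[of s "Suc 0" j] have "j \<in> dom \<theta>"
        unfolding match_dom[OF Subst] by auto
      then obtain v where v: "\<theta> j = Some v" by auto
      show ?thesis using match_component[OF Subst v] one v wf by auto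
    next
      case (Suc i j)
      with y wf well_formed_fv[of s "Suc (Suc i)" j] show ?thesis by auto
    qed
    have "well_formed (msubst (beta_env \<theta>) id s)"
      using wf env by (intro well_formed_msubst) auto
    moreover have "fv (msubst (beta_env \<theta>) id s) \<subseteq> fv (App (Lam n p s) u)"
    proof
      fix x assume "x \<in> fv (msubst (beta_env \<theta>) id s)"
      with fv_msubst[of s x "beta_env \<theta>" id] wf obtain y where "y \<in> fv s" "x \<in> fv (beta_env \<theta> y)"
        by auto
      with env show "x \<in> fv (App (Lam n p s) u)" by blast
    qed
    moreover have "fm (msubst (beta_env \<theta>) id s) \<subseteq> fm (App (Lam n p s) u)"
    proof
      fix x assume "x \<in> fm (msubst (beta_env \<theta>) id s)"
      with fm_msubst[of s x "beta_env \<theta>" id] wf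
      have "x \<in> fm s \<or> (\<exists>y\<in>fv s. x \<in> fm (beta_env \<theta> y))" by auto
      with env show "x \<in> fm (App (Lam n p s) u)" by fastforce
    qed
    ultimately show ?thesis using Subst by simp
  qed (use assms in auto)
  then show "well_formed (contract (match n p u) s)"
    and "fv (contract (match n p u) s) \<subseteq> fv (App (Lam n p s) u)"
    and "fm (contract (match n p u) s) \<subseteq> fm (App (Lam n p s) u)" by auto
qed

lemma fv_perm_mat [simp]: "fv (perm_mat k \<pi> t) = fv t"
  by (induction t arbitrary: k) auto

lemma fm_perm_var [simp]: "fm (perm_var k \<pi> t) = fm t"
  by (induction t arbitrary: k) auto

text \<open>A permutation of \<open>{1..n}\<close> respects the range condition, and it moves only
  bound indices.\<close>

lemma perm_invariants:
  assumes \<pi>: "\<pi> permutes {1..n}" and wf: "well_formed (Lam n p s)"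
  shows "well_formed (Lam n (perm_mat 1 \<pi> p) (perm_var 1 \<pi> s))"
    and "fv (Lam n (perm_mat 1 \<pi> p) (perm_var 1 \<pi> s)) \<subseteq> fv (Lam n p s)"
    and "fm (Lam n (perm_mat 1 \<pi> p) (perm_var 1 \<pi> s)) \<subseteq> fm (Lam n p s)"
proof -
  have pos: "1 \<le> \<pi> j" if "1 \<le> j" for j
    using that permutes_in_image[OF \<pi>, of j] permutes_not_in[OF \<pi>, of j] by (cases "j \<in> {1..n}") auto
  have le: "\<pi> j \<le> n" if "j \<le> n" for j
    using that permutes_in_image[OF \<pi>, of j] permutes_not_in[OF \<pi>, of j] by (cases "j \<in> {1..n}") auto
  have ren: "index_renaming (perm_index 1 \<pi>)" using permutes_bij[OF \<pi>] by simp
  have fm: "fm (perm_mat 1 \<pi> p) \<subseteq> perm_index 1 \<pi> ` fm p"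
  proof
    fix x assume "x \<in> fm (perm_mat 1 \<pi> p)"
    then have "x \<in> fm (msubst (case_prod Var) (perm_index 1 \<pi>) p)" by (simp add: perm_mat_eq_rename)
    with fm_msubst[OF _ this] wf show "x \<in> perm_index 1 \<pi> ` fm p" by (auto split: prod.splits)
  qed
  have fv: "fv (perm_var 1 \<pi> s) \<subseteq> perm_index 1 \<pi> ` fv s"
  proof
    fix x assume "x \<in> fv (perm_var 1 \<pi> s)"
    then have "x \<in> fv (rename (perm_index 1 \<pi>) id s)" by (simp add: perm_var_eq_rename)
    with fv_msubst[OF _ this] wf obtain y where "y \<in> fv s" "x \<in> fv (case_prod Var (perm_index 1 \<pi> y))"
      by auto
    then show "x \<in> perm_index 1 \<pi> ` fv s" by (cases "perm_index 1 \<pi> y") (auto intro: rev_image_eqI)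
  qed
  have "well_formed (case_prod Var y)" if "y \<in> fv p" for y
    using that wf well_formed_fv[of p] by (cases y) auto
  then have "well_formed (msubst (case_prod Var) (perm_index 1 \<pi>) p)"
    using wf pos ren by (intro well_formed_msubst) auto
  then have "well_formed (perm_mat 1 \<pi> p)" by (simp add: perm_mat_eq_rename)
  moreover have "well_formed (case_prod Var (perm_index 1 \<pi> y))" if "y \<in> fv s" for y
    using that wf well_formed_fv[of s] pos by (cases y) auto
  then have "well_formed (rename (perm_index 1 \<pi>) id s)"
    using wf by (intro well_formed_msubst) auto
  then have "well_formed (perm_var 1 \<pi> s)" by (simp add: perm_var_eq_rename)
  moreover have "j \<le> n" if "(1, j) \<in> fm (perm_mat 1 \<pi> p)" for j
    using that fm wf le by (fastforce split: if_splits)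
  moreover have "j \<le> n" if "(1, j) \<in> fv (perm_var 1 \<pi> s)" for j
    using that fv wf le by (fastforce split: if_splits)
  ultimately show "well_formed (Lam n (perm_mat 1 \<pi> p) (perm_var 1 \<pi> s))" by simp
  show "fv (Lam n (perm_mat 1 \<pi> p) (perm_var 1 \<pi> s)) \<subseteq> fv (Lam n p s)"
    using fv by (fastforce split: if_splits)
  show "fm (Lam n (perm_mat 1 \<pi> p) (perm_var 1 \<pi> s)) \<subseteq> fm (Lam n p s)"
    using fm by (fastforce split: if_splits)
qed

lemma Lam_invariants:
  assumes "well_formed (Lam n p s)" "well_formed p'" "well_formed s'"
    and "fv p' \<subseteq> fv p" "fv s' \<subseteq> fv s" "fm p' \<subseteq> fm p" "fm s' \<subseteq> fm s"
  shows "well_formed (Lam n p' s')" "fv (Lam n p' s') \<subseteq> fv (Lam n p s)"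
    "fm (Lam n p' s') \<subseteq> fm (Lam n p s)"
  using assms by auto

text \<open>The inclusions strengthen the induction: the range conditions of an enclosing binder
  survive because no new free index appears.\<close>

lemma par_red_invariants:
  "par_red t t' \<Longrightarrow> well_formed t \<Longrightarrow> well_formed t' \<and> fv t' \<subseteq> fv t \<and> fm t' \<subseteq> fm t"
proof (induction rule: par_red.induct)
  case (Lam p p' s s' \<pi> n)
  then have "well_formed (Lam n p' s')" "fv (Lam n p' s') \<subseteq> fv (Lam n p s)"
    "fm (Lam n p' s') \<subseteq> fm (Lam n p s)"
    using Lam_invariants[of n p s p' s'] by simp_all
  then show ?case using perm_invariants[OF Lam.hyps(3), of p' s'] by blast
next
  case (beta p p' s s' u u' n)
  then have u: "well_formed u'" "fv u' \<subseteq> fv u" "fm u' \<subseteq> fm u" by simp_all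
  have Lam: "well_formed (Lam n p' s')" "fv (Lam n p' s') \<subseteq> fv (Lam n p s)"
    "fm (Lam n p' s') \<subseteq> fm (Lam n p s)"
    using beta Lam_invariants[of n p s p' s'] by simp_all
  have "fv (App (Lam n p' s') u') \<subseteq> fv (App (Lam n p s) u)"
    "fm (App (Lam n p' s') u') \<subseteq> fm (App (Lam n p s) u)"
    unfolding fv.simps(3) fm.simps(3) using u Lam by (meson Un_mono)+
  then show ?case using contract_invariants[OF Lam(1) u(1) beta.hyps(4)] by blast
qed auto

section \<open>Reduction modulo permutation\<close>

lemma raw_red_imp_par_red: "raw_red t t' \<Longrightarrow> well_formed t \<Longrightarrow> par_red t t'"
proof (induction rule: raw_red.induct)
  case (beta n p u s)
  then have "match n p u \<noteq> Wait" by (cases "match n p u") (auto simp: match_inc_var)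
  then show ?case
    using beta.prems par_red.beta[of p p s s u u n] by (simp add: dec_var_apply_match)
qed (auto intro: par_red.App par_red_LamI)

lemma rtranclp_image:
  assumes "R\<^sup>*\<^sup>* x y" "\<And>x y. R x y \<Longrightarrow> S (f x) (f y)"
  shows "S\<^sup>*\<^sup>* (f x) (f y)"
  using assms(1) by induction (auto intro: assms(2) rtranclp.rtrancl_into_rtrancl)

lemma par_reds_App:
  assumes "par_red\<^sup>*\<^sup>* t t'" "par_red\<^sup>*\<^sup>* u u'"
  shows "par_red\<^sup>*\<^sup>* (App t u) (App t' u')"
proof -
  have "par_red\<^sup>*\<^sup>* (App t u) (App t' u)"
    using assms(1) by (rule rtranclp_image[where f = "\<lambda>t. App t u"]) (simp add: par_red.App)
  also have "par_red\<^sup>*\<^sup>* (App t' u) (App t' u')"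
    using assms(2) by (rule rtranclp_image) (simp add: par_red.App)
  finally show ?thesis .
qed

lemma par_reds_Lam:
  assumes "par_red\<^sup>*\<^sup>* p p'" "par_red\<^sup>*\<^sup>* s s'"
  shows "par_red\<^sup>*\<^sup>* (Lam n p s) (Lam n p' s')"
proof -
  have "par_red\<^sup>*\<^sup>* (Lam n p s) (Lam n p' s)"
    using assms(1) by (rule rtranclp_image[where f = "\<lambda>p. Lam n p s"]) (simp add: par_red_LamI)
  also have "par_red\<^sup>*\<^sup>* (Lam n p' s) (Lam n p' s')"
    using assms(2) by (rule rtranclp_image) (simp add: par_red_LamI)
  finally show ?thesis .
qed

text \<open>Proving both directions at once settles the symmetry rule; a permutation is undone by a
  parallel step with its inverse.\<close>

lemma perm_eq_imp_par_reds: "perm_eq t u \<Longrightarrow> par_red\<^sup>*\<^sup>* t u \<and> par_red\<^sup>*\<^sup>* u t"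
proof (induction rule: perm_eq.induct)
  case (perm \<pi> n p s)
  have "par_red (Lam n p s) (Lam n (perm_mat 1 \<pi> p) (perm_var 1 \<pi> s))"
    using perm by (intro par_red.Lam) simp_all
  moreover have "par_red (Lam n (perm_mat 1 \<pi> p) (perm_var 1 \<pi> s))
    (Lam n (perm_mat 1 (inv \<pi>) (perm_mat 1 \<pi> p)) (perm_var 1 (inv \<pi>) (perm_var 1 \<pi> s)))"
    using perm by (intro par_red.Lam permutes_inv) simp_all
  ultimately show ?case
    using permutes_inv_o[OF perm] by (auto simp: perm_mat_perm_mat perm_var_perm_var)
qed (auto intro: par_reds_App par_reds_Lam rtranclp_trans)

text \<open>Raw counterpart of \<open>red\<close>: the \<open>perm_eq\<close> steps become
  equalities in the quotient.\<close>

definition step :: "pterm \<Rightarrow> pterm \<Rightarrow> bool" where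
  "step t u \<longleftrightarrow> perm_eq t u \<or> raw_red t u"

lemma steps_App:
  assumes "step\<^sup>*\<^sup>* t t'" "step\<^sup>*\<^sup>* u u'"
  shows "step\<^sup>*\<^sup>* (App t u) (App t' u')"
proof -
  have "step\<^sup>*\<^sup>* (App t u) (App t' u)"
    using assms(1) by (rule rtranclp_image[where f = "\<lambda>t. App t u"])
      (auto simp: step_def intro: perm_eq.App perm_eq.refl raw_red.AppL)
  also have "step\<^sup>*\<^sup>* (App t' u) (App t' u')"
    using assms(2) by (rule rtranclp_image)
      (auto simp: step_def intro: perm_eq.App perm_eq.refl raw_red.AppR)
  finally show ?thesis .
qed

lemma steps_Lam:
  assumes "step\<^sup>*\<^sup>* p p'" "step\<^sup>*\<^sup>* s s'"
  shows "step\<^sup>*\<^sup>* (Lam n p s) (Lam n p' s')"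
proof -
  have "step\<^sup>*\<^sup>* (Lam n p s) (Lam n p' s)"
    using assms(1) by (rule rtranclp_image[where f = "\<lambda>p. Lam n p s"])
      (auto simp: step_def intro: perm_eq.Lam perm_eq.refl raw_red.LamP)
  also have "step\<^sup>*\<^sup>* (Lam n p' s) (Lam n p' s')"
    using assms(2) by (rule rtranclp_image)
      (auto simp: step_def intro: perm_eq.Lam perm_eq.refl raw_red.LamB)
  finally show ?thesis .
qed

text \<open>The components are reduced first and the resulting abstraction is then permuted or
  contracted; it is still well-formed, so the contraction is a genuine reduction step.\<close>

lemma par_red_imp_steps: "par_red t t' \<Longrightarrow> well_formed t \<Longrightarrow> step\<^sup>*\<^sup>* t t'"
proof (induction rule: par_red.induct)
  case (App t t' u u')
  then show ?case by (simp add: steps_App)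
next
  case (Lam p p' s s' \<pi> n)
  then have "step\<^sup>*\<^sup>* (Lam n p s) (Lam n p' s')" by (simp add: steps_Lam)
  also have "step (Lam n p' s') (Lam n (perm_mat 1 \<pi> p') (perm_var 1 \<pi> s'))"
    unfolding step_def using perm_eq.perm[OF Lam.hyps(3)] ..
  finally show ?case .
next
  case (beta p p' s s' u u' n)
  then have wf: "well_formed (Lam n p' s')"
    using par_red_invariants[OF par_red_LamI[of p p' s s' n]] by simp
  have "step\<^sup>*\<^sup>* (App (Lam n p s) u) (App (Lam n p' s') u')"
    using beta by (simp add: steps_App steps_Lam)
  also have "match n p' (inc_var 0 u') \<noteq> Wait"
    using beta.hyps(4) by (cases "match n p' u'") (auto simp: match_inc_var)
  then have "step (App (Lam n p' s') u') (contract (match n p' u') s')"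
    unfolding step_def dec_var_apply_match[OF wf beta.hyps(4), symmetric]
    by (intro disjI2 raw_red.beta)
  finally show ?case .
qed simp_all

section \<open>Passage to the quotient\<close>

lemma abs_ppc_term_eq_iff:
  assumes "well_formed t" "well_formed u"
  shows "abs_ppc_term t = abs_ppc_term u \<longleftrightarrow> perm_eq t u"
  using Quotient_rel[OF Quotient_ppc_term, of t u] assms by (simp add: term_eq_def perm_eq.refl)

lemma ppc_term_cases:
  obtains t where "well_formed t" "T = abs_ppc_term t"
  using Quotient_abs_rep[OF Quotient_ppc_term, of T] Quotient_rep_reflp[OF Quotient_ppc_term, of T]
  by (metis term_eq_def)

lemma steps_imp_reds:
  assumes "step\<^sup>*\<^sup>* t u" "well_formed t"
  shows "well_formed u \<and> red\<^sup>*\<^sup>* (abs_ppc_term t) (abs_ppc_term u)"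
  using assms(1)
proof induction
  case (step u v)
  then have wf: "well_formed u" and reds: "red\<^sup>*\<^sup>* (abs_ppc_term t) (abs_ppc_term u)" by simp_all
  \<comment> \<open>Through parallel steps, well-formedness is preserved by \<open>perm_eq\<close>
    as well as by \<open>raw_red\<close>.\<close>
  have par_reds: "par_red\<^sup>*\<^sup>* u v"
    using step.hyps(2) wf perm_eq_imp_par_reds raw_red_imp_par_red by (auto simp: step_def)
  then have wf': "well_formed v"
    by induction (use wf par_red_invariants in auto)
  from step.hyps(2) consider "perm_eq u v" | "raw_red u v" by (auto simp: step_def)
  then show ?case
  proof cases
    case 1
    then show ?thesis using wf wf' reds abs_ppc_term_eq_iff by metis
  next
    case 2
    then have "abs_ppc_term u \<rightarrow>\<^sub>d\<^sub>B abs_ppc_term v" using wf wf' by (auto simp: red_def)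
    then show ?thesis using wf' reds by simp
  qed
qed (use assms in simp)

lemma par_reds_imp_reds:
  assumes "par_red\<^sup>*\<^sup>* t u" "well_formed t"
  shows "red\<^sup>*\<^sup>* (abs_ppc_term t) (abs_ppc_term u)"
proof -
  have "well_formed u \<and> step\<^sup>*\<^sup>* t u" using assms(1)
    by induction (use assms(2) par_red_invariants par_red_imp_steps in \<open>auto intro: rtranclp_trans\<close>)
  then show ?thesis using steps_imp_reds assms(2) by blast
qed

text \<open>Each step of \<open>red\<close> may choose a new representative; the change is a
  \<open>perm_eq\<close>, which parallel steps absorb. Hence any chosen \<open>t\<close> can serve
  as the start.\<close>

lemma reds_imp_par_reds:
  assumes "red\<^sup>*\<^sup>* (abs_ppc_term t) U" "well_formed t"
  obtains u where "U = abs_ppc_term u" "well_formed u" "par_red\<^sup>*\<^sup>* t u"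
proof -
  have "\<exists>u. U = abs_ppc_term u \<and> well_formed u \<and> par_red\<^sup>*\<^sup>* t u" using assms(1)
  proof induction
    case base
    then show ?case using assms(2) by blast
  next
    case (step U V)
    then obtain u where u: "U = abs_ppc_term u" "well_formed u" "par_red\<^sup>*\<^sup>* t u" by blast
    from step.hyps(2) obtain u' v where v: "well_formed u'" "well_formed v"
      "U = abs_ppc_term u'" "V = abs_ppc_term v" "raw_red u' v" by (auto simp: red_def)
    have "perm_eq u u'" using u v abs_ppc_term_eq_iff by metis
    then have "par_red\<^sup>*\<^sup>* u u'" using perm_eq_imp_par_reds by blast
    moreover have "par_red u' v" using v raw_red_imp_par_red by blast
    ultimately have "par_red\<^sup>*\<^sup>* t v" using u(3) by (meson rtranclp.rtrancl_into_rtrancl rtranclp_trans)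
    then show ?case using v by blast
  qed
  then show thesis using that by blast
qed

theorem theorem5p7:
  fixes t t\<^sub>0 t\<^sub>1 :: ppc_term
  assumes "red\<^sup>*\<^sup>* t t\<^sub>0" and "red\<^sup>*\<^sup>* t t\<^sub>1"
  shows "\<exists>t'. red\<^sup>*\<^sup>* t\<^sub>0 t' \<and> red\<^sup>*\<^sup>* t\<^sub>1 t'"
proof -
  obtain r where r: "well_formed r" "t = abs_ppc_term r" by (rule ppc_term_cases)
  \<comment> \<open>Both sequences are lifted from the same representative \<open>r\<close>, so that
    confluence on raw terms applies.\<close>
  obtain r\<^sub>0 where r0: "t\<^sub>0 = abs_ppc_term r\<^sub>0" "well_formed r\<^sub>0" "par_red\<^sup>*\<^sup>* r r\<^sub>0"
    using assms(1) r by (auto elim: reds_imp_par_reds)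
  obtain r\<^sub>1 where r1: "t\<^sub>1 = abs_ppc_term r\<^sub>1" "well_formed r\<^sub>1" "par_red\<^sup>*\<^sup>* r r\<^sub>1"
    using assms(2) r by (auto elim: reds_imp_par_reds)
  obtain r' where "par_red\<^sup>*\<^sup>* r\<^sub>0 r'" "par_red\<^sup>*\<^sup>* r\<^sub>1 r'"
    using confluentpD[OF confluentp_par_red r0(3) r1(3)] by blast
  then show ?thesis using r0 r1 par_reds_imp_reds by blast
qed

end
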